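(* Let $X$ be a (non-empty) path-connected Hausdorff space, $x_0\in X$, and let $H\leq \pi_1(X,x_0)$ be a subgroup. There exists a map $p:(E,e_0)\to (X,x_0)$ with the continuous path-covering property, with $E$ path connected, such that $p_{\#}(\pi_1(E,e_0))=H$, if and only if the coset space $\pi_1(X,x_0)/H$ is totally path-disconnected; and such a map $p$ is unique up to weak equivalence (any two such maps with the same $H$ are weakly equivalent). Moreover: (1) among the maps $p:E\to X$ with the continuous path-covering property for which $ev_1:P(E,e)\to E$ is a topological quotient map, the maps are classified up to equivalence: there exists such a map $p:(E,e_0)\to(X,x_0)$ with $p_{\#}(\pi_1(E,e_0))=H$ if and only if $\pi_1(X,x_0)/H$ is totally path-disconnected, and any two such maps with the same $H$ are equivalent; (2) every map $p:E\to X$ with the continuous path-covering property (with $E$ non-empty and path connected) is weakly equivalent to a map $p':E'\to X$ with the continuous path-covering property for which $ev_1:P(E',e')\to E'$ is a topological quotient map.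
   Context: Maps are continuous; all total spaces $E, E', E_i$ of maps to $X$ are assumed non-empty and path connected. Let $I=[0,1]$. For a space $Y$ and $y\in Y$, $P(Y,y)$ is the space of paths $\alpha:I\to Y$ with $\alpha(0)=y$, with the compact-open topology, and $ev_1:P(Y,y)\to Y$ is $ev_1(\alpha)=\alpha(1)$. (For path-connected $Y$, whether $ev_1$ is a quotient map does not depend on the choice of $y$.) A map $p:E\to X$ has the continuous path-covering property if for every $e\in E$ the induced map $P(p):P(E,e)\to P(X,p(e))$, $\alpha\mapsto p\circ\alpha$, is a homeomorphism. $\pi_1(X,x_0)$ carries the quotient topology from the loop space $\Omega(X,x_0)$ (compact-open topology) via $\alpha\mapsto[\alpha]$, and the set $\pi_1(X,x_0)/H$ of cosets $H[\alpha]$ carries the quotient topology from $\pi_1(X,x_0)$. A space is totally path-disconnected if every path in it is constant. Let $p_1:E_1\to X$ and $p_2:E_2\to X$ have the continuous path-covering property. They are equivalent if there is a homeomorphism $h:E_1\to E_2$ with $p_2\circ h=p_1$. A simple weak equivalence between $p_1$ and $p_2$ is a triple $(p_3,f_1,f_2)$ where $p_3:E_3\to X$ has the continuous path-covering property and $f_i:E_3\to E_i$ ($i\in\{1,2\}$) are weak homotopy equivalences with $p_i\circ f_i=p_3$; in this case write $p_1\sim_s p_2$. The maps $p_1,p_2$ are weakly equivalent if there is a finite chain $p_1=q_1\sim_s q_2\sim_s\cdots\sim_s q_m=p_2$ of maps to $X$ with the continuous path-covering property. *)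

theory Defs
  imports "HOL-Analysis.Analysis" "HOL-Algebra.Coset"
begin

section \<open>Path spaces\<close>

text \<open>Continuous maps are represented by functions that are extensional outside the domain, so
  that equality of functions is equality of maps.\<close>

definition compact_open_topology :: "'a topology \<Rightarrow> 'b topology \<Rightarrow> ('a \<Rightarrow> 'b) topology" where
  "compact_open_topology A Y = topology_generated_by
     {{f \<in> extensional (topspace A). continuous_map A Y f \<and> f ` K \<subseteq> U} | K U.
        compactin A K \<and> openin Y U}"

lemma topspace_compact_open_topology:
  "topspace (compact_open_topology A Y) = {f \<in> extensional (topspace A). continuous_map A Y f}"
proof -
  have "{f \<in> extensional (topspace A). continuous_map A Y f} =
      {f \<in> extensional (topspace A). continuous_map A Y f \<and> f ` {} \<subseteq> {}}"
    by simp
  then have "{f \<in> extensional (topspace A). continuous_map A Y f} \<in>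
     {{f \<in> extensional (topspace A). continuous_map A Y f \<and> f ` K \<subseteq> U} | K U.
        compactin A K \<and> openin Y U}"
    using compactin_empty openin_empty by blast
  then show ?thesis
    unfolding compact_open_topology_def topology_generated_by_topspace by blast
qed

abbreviation unit_interval :: "real topology" where
  "unit_interval \<equiv> top_of_set {0..1}"

definition path_space :: "'a topology \<Rightarrow> 'a \<Rightarrow> (real \<Rightarrow> 'a) topology" where
  "path_space Y y = subtopology (compact_open_topology unit_interval Y) {\<alpha>. \<alpha> 0 = y}"

definition loop_space :: "'a topology \<Rightarrow> 'a \<Rightarrow> (real \<Rightarrow> 'a) topology" where
  "loop_space Y y = subtopology (compact_open_topology unit_interval Y) {\<alpha>. \<alpha> 0 = y \<and> \<alpha> 1 = y}"

lemma topspace_path_space: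
  "topspace (path_space Y y) = {\<alpha> \<in> extensional {0..1}. pathin Y \<alpha> \<and> \<alpha> 0 = y}"
  by (auto simp: path_space_def topspace_compact_open_topology pathin_def)

lemma topspace_loop_space:
  "topspace (loop_space Y y) = {\<alpha> \<in> extensional {0..1}. pathin Y \<alpha> \<and> \<alpha> 0 = y \<and> \<alpha> 1 = y}"
  by (auto simp: loop_space_def topspace_compact_open_topology pathin_def)

section \<open>The continuous path-covering property\<close>

definition has_continuous_path_covering :: "'e topology \<Rightarrow> 'a topology \<Rightarrow> ('e \<Rightarrow> 'a) \<Rightarrow> bool" where
  "has_continuous_path_covering E X p \<longleftrightarrow> continuous_map E X p \<and>
     (\<forall>e \<in> topspace E.
        homeomorphic_map (path_space E e) (path_space X (p e)) (\<lambda>\<alpha>. compose {0..1} p \<alpha>))"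

text \<open>The standing assumption that total spaces are non-empty and path connected is included.\<close>

definition path_covering_map :: "'e topology \<Rightarrow> 'a topology \<Rightarrow> ('e \<Rightarrow> 'a) \<Rightarrow> bool" where
  "path_covering_map E X p \<longleftrightarrow>
     topspace E \<noteq> {} \<and> path_connected_space E \<and> has_continuous_path_covering E X p"

definition ev1_quotient :: "'e topology \<Rightarrow> bool" where
  "ev1_quotient E \<longleftrightarrow> (\<forall>e \<in> topspace E. quotient_map (path_space E e) E (\<lambda>\<alpha>. \<alpha> 1))"

text \<open>Every total space injects into the type \<^typ>\<open>(real \<Rightarrow> 'a) set\<close>, where \<^typ>\<open>'a\<close> is the point
  type of the base. This type therefore serves as carrier for all existentially quantified total
  spaces.\<close>

lemma path_covering_map_inject:
  fixes X :: "'a topology" and E :: "'e topology"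
  assumes "path_covering_map E X p"
  shows "\<exists>j :: 'e \<Rightarrow> (real \<Rightarrow> 'a) set. inj_on j (topspace E)"
proof -
  obtain e where e: "e \<in> topspace E"
    using assms unfolding path_covering_map_def by blast
  let ?P = "topspace (path_space E e)"
  define j where "j = (\<lambda>x. compose {0..1} p ` {\<alpha> \<in> ?P. \<alpha> 1 = x})"
  have inj: "inj_on (compose {0..1} p) ?P"
    using assms e
    unfolding path_covering_map_def has_continuous_path_covering_def
    by (auto dest: homeomorphic_imp_injective_map)
  have ne: "\<exists>\<alpha> \<in> ?P. \<alpha> 1 = x" if x: "x \<in> topspace E" for x
  proof -
    obtain g where g: "pathin E g" "g 0 = e" "g 1 = x"
      using assms e x unfolding path_covering_map_def path_connected_space_def by blast
    have "pathin E (restrict g {0..1})"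
      using g(1) unfolding pathin_def by (rule continuous_map_eq) auto
    then show ?thesis
      using g by (intro bexI[of _ "restrict g {0..1}"]) (auto simp: topspace_path_space)
  qed
  have "inj_on j (topspace E)"
  proof (rule inj_onI)
    fix x y assume x: "x \<in> topspace E" and eq: "j x = j y"
    obtain \<alpha> where \<alpha>: "\<alpha> \<in> ?P" "\<alpha> 1 = x"
      using ne[OF x] by blast
    then have "compose {0..1} p \<alpha> \<in> j y"
      using eq unfolding j_def by blast
    then obtain \<beta> where \<beta>: "\<beta> \<in> ?P" "\<beta> 1 = y" "compose {0..1} p \<alpha> = compose {0..1} p \<beta>"
      unfolding j_def by blast
    then have "\<alpha> = \<beta>"
      using inj_onD[OF inj] \<alpha> by blast
    then show "x = y"
      using \<alpha> \<beta> by simp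
  qed
  then show ?thesis by blast
qed

section \<open>The topologized fundamental group and its coset spaces\<close>

definition quotient_topology :: "'a topology \<Rightarrow> ('a \<Rightarrow> 'b) \<Rightarrow> 'b topology" where
  "quotient_topology X f =
     topology (\<lambda>U. U \<subseteq> f ` topspace X \<and> openin X {x \<in> topspace X. f x \<in> U})"

lemma openin_quotient_topology:
  "openin (quotient_topology X f) U \<longleftrightarrow>
     U \<subseteq> f ` topspace X \<and> openin X {x \<in> topspace X. f x \<in> U}"
proof -
  have "istopology (\<lambda>U. U \<subseteq> f ` topspace X \<and> openin X {x \<in> topspace X. f x \<in> U})"
    unfolding istopology_def
  proof (intro conjI allI impI)
    fix S T
    assume "S \<subseteq> f ` topspace X \<and> openin X {x \<in> topspace X. f x \<in> S}"
      and "T \<subseteq> f ` topspace X \<and> openin X {x \<in> topspace X. f x \<in> T}"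
    moreover have "{x \<in> topspace X. f x \<in> S \<inter> T} =
        {x \<in> topspace X. f x \<in> S} \<inter> {x \<in> topspace X. f x \<in> T}" by auto
    ultimately show "S \<inter> T \<subseteq> f ` topspace X" "openin X {x \<in> topspace X. f x \<in> S \<inter> T}"
      by auto
  next
    fix \<K>
    assume \<K>: "\<forall>K\<in>\<K>. K \<subseteq> f ` topspace X \<and> openin X {x \<in> topspace X. f x \<in> K}"
    then show "\<Union>\<K> \<subseteq> f ` topspace X" by blast
    have "{x \<in> topspace X. f x \<in> \<Union>\<K>} = (\<Union>K\<in>\<K>. {x \<in> topspace X. f x \<in> K})" by auto
    then show "openin X {x \<in> topspace X. f x \<in> \<Union>\<K>}" using \<K> by auto
  qed
  then show ?thesis by (simp add: quotient_topology_def)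
qed

lemma topspace_quotient_topology: "topspace (quotient_topology X f) = f ` topspace X"
proof -
  have "{x \<in> topspace X. f x \<in> f ` topspace X} = topspace X" by auto
  then have "openin (quotient_topology X f) (f ` topspace X)"
    by (simp add: openin_quotient_topology)
  moreover have "topspace (quotient_topology X f) \<subseteq> f ` topspace X"
    using openin_topspace[of "quotient_topology X f"] unfolding openin_quotient_topology by blast
  ultimately show ?thesis by (meson openin_subset subset_antisym)
qed

lemma quotient_map_quotient_topology: "quotient_map X (quotient_topology X f) f"
  unfolding quotient_map_def topspace_quotient_topology openin_quotient_topology by blast

definition loop_homotopy :: "'a topology \<Rightarrow> 'a \<Rightarrow> ((real \<Rightarrow> 'a) \<times> (real \<Rightarrow> 'a)) set" where
  "loop_homotopy X x0 = {(\<alpha>, \<beta>). \<alpha> \<in> topspace (loop_space X x0) \<and> \<beta> \<in> topspace (loop_space X x0) \<and>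
     homotopic_with (\<lambda>\<gamma>. \<gamma> 0 = x0 \<and> \<gamma> 1 = x0) unit_interval X \<alpha> \<beta>}"

definition loop_class :: "'a topology \<Rightarrow> 'a \<Rightarrow> (real \<Rightarrow> 'a) \<Rightarrow> (real \<Rightarrow> 'a) set" where
  "loop_class X x0 \<alpha> = loop_homotopy X x0 `` {\<alpha>}"

definition concat_loops :: "(real \<Rightarrow> 'a) \<Rightarrow> (real \<Rightarrow> 'a) \<Rightarrow> (real \<Rightarrow> 'a)" where
  "concat_loops \<alpha> \<beta> = restrict (\<lambda>t. if t \<le> 1/2 then \<alpha> (2 * t) else \<beta> (2 * t - 1)) {0..1}"

definition fundamental_group :: "'a topology \<Rightarrow> 'a \<Rightarrow> (real \<Rightarrow> 'a) set monoid" where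
  "fundamental_group X x0 =
     \<lparr>carrier = loop_class X x0 ` topspace (loop_space X x0),
      monoid.mult = (\<lambda>A B. \<Union>\<alpha>\<in>A. \<Union>\<beta>\<in>B. loop_class X x0 (concat_loops \<alpha> \<beta>)),
      one = loop_class X x0 (restrict (\<lambda>_. x0) {0..1})\<rparr>"

definition fundamental_group_topology :: "'a topology \<Rightarrow> 'a \<Rightarrow> (real \<Rightarrow> 'a) set topology" where
  "fundamental_group_topology X x0 = quotient_topology (loop_space X x0) (loop_class X x0)"

definition fundamental_group_map ::
    "'a topology \<Rightarrow> 'a \<Rightarrow> ('e \<Rightarrow> 'a) \<Rightarrow> (real \<Rightarrow> 'e) set \<Rightarrow> (real \<Rightarrow> 'a) set" where
  "fundamental_group_map X x0 p A = (\<Union>\<alpha>\<in>A. loop_class X x0 (compose {0..1} p \<alpha>))"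

text \<open>The points are the right cosets of \<open>H\<close>.\<close>

definition coset_space ::
    "'a topology \<Rightarrow> 'a \<Rightarrow> (real \<Rightarrow> 'a) set set \<Rightarrow> (real \<Rightarrow> 'a) set set topology" where
  "coset_space X x0 H =
     quotient_topology (fundamental_group_topology X x0) (\<lambda>a. H #>\<^bsub>fundamental_group X x0\<^esub> a)"

lemma topspace_coset_space:
  "topspace (coset_space X x0 H) = rcosets\<^bsub>fundamental_group X x0\<^esub> H"
  by (auto simp: coset_space_def fundamental_group_topology_def topspace_quotient_topology
      RCOSETS_def fundamental_group_def)

definition totally_path_disconnected :: "'a topology \<Rightarrow> bool" where
  "totally_path_disconnected Y \<longleftrightarrow>
     (\<forall>\<gamma>. pathin Y \<gamma> \<longrightarrow> (\<forall>s\<in>{0..1}. \<forall>t\<in>{0..1}. \<gamma> s = \<gamma> t))"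

definition realizes_subgroup ::
    "'a topology \<Rightarrow> 'a \<Rightarrow> (real \<Rightarrow> 'a) set set \<Rightarrow> 'e topology \<Rightarrow> ('e \<Rightarrow> 'a) \<Rightarrow> 'e \<Rightarrow> bool" where
  "realizes_subgroup X x0 H E p e0 \<longleftrightarrow>
     path_covering_map E X p \<and> e0 \<in> topspace E \<and> p e0 = x0 \<and>
     fundamental_group_map X x0 p ` carrier (fundamental_group E e0) = H"

section \<open>Weak homotopy equivalences\<close>

definition cube :: "nat \<Rightarrow> (nat \<Rightarrow> real) topology" where
  "cube n = product_topology (\<lambda>_. unit_interval) {..<n}"

definition cube_boundary :: "nat \<Rightarrow> (nat \<Rightarrow> real) set" where
  "cube_boundary n = {x \<in> topspace (cube n). \<exists>i<n. x i = 0 \<or> x i = 1}"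

definition spheroids :: "nat \<Rightarrow> 'a topology \<Rightarrow> 'a \<Rightarrow> ((nat \<Rightarrow> real) \<Rightarrow> 'a) set" where
  "spheroids n Y y = {\<alpha>. continuous_map (cube n) Y \<alpha> \<and> (\<forall>x \<in> cube_boundary n. \<alpha> x = y)}"

definition spheroid_homotopy ::
    "nat \<Rightarrow> 'a topology \<Rightarrow> 'a \<Rightarrow> (((nat \<Rightarrow> real) \<Rightarrow> 'a) \<times> ((nat \<Rightarrow> real) \<Rightarrow> 'a)) set" where
  "spheroid_homotopy n Y y =
     {(\<alpha>, \<beta>). homotopic_with (\<lambda>\<gamma>. \<forall>x \<in> cube_boundary n. \<gamma> x = y) (cube n) Y \<alpha> \<beta>}"

definition homotopy_classes ::
    "nat \<Rightarrow> 'a topology \<Rightarrow> 'a \<Rightarrow> ((nat \<Rightarrow> real) \<Rightarrow> 'a) set set" where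
  "homotopy_classes n Y y = spheroids n Y y // spheroid_homotopy n Y y"

definition homotopy_classes_map :: "nat \<Rightarrow> 'b topology \<Rightarrow> 'b \<Rightarrow> ('a \<Rightarrow> 'b) \<Rightarrow>
    ((nat \<Rightarrow> real) \<Rightarrow> 'a) set \<Rightarrow> ((nat \<Rightarrow> real) \<Rightarrow> 'b) set" where
  "homotopy_classes_map n Z z f A = (\<Union>\<alpha>\<in>A. spheroid_homotopy n Z z `` {f \<circ> \<alpha>})"

definition path_components_map ::
    "'b topology \<Rightarrow> ('a \<Rightarrow> 'b) \<Rightarrow> 'a set \<Rightarrow> 'b set" where
  "path_components_map Z f C = (\<Union>x\<in>C. path_component_of_set Z (f x))"

text \<open>The maps induced on homotopy groups are homomorphisms, so they are isomorphisms as soon as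
  they are bijective; the group structure need not be mentioned.\<close>

definition weak_homotopy_equivalence :: "'a topology \<Rightarrow> 'b topology \<Rightarrow> ('a \<Rightarrow> 'b) \<Rightarrow> bool" where
  "weak_homotopy_equivalence Y Z f \<longleftrightarrow> continuous_map Y Z f \<and>
     bij_betw (path_components_map Z f) (path_components_of Y) (path_components_of Z) \<and>
     (\<forall>n\<ge>1. \<forall>y \<in> topspace Y. bij_betw (homotopy_classes_map n Z (f y) f)
        (homotopy_classes n Y y) (homotopy_classes n Z (f y)))"

section \<open>Equivalence and weak equivalence of maps to a fixed base\<close>

definition equivalent_maps ::
    "'e1 topology \<Rightarrow> ('e1 \<Rightarrow> 'a) \<Rightarrow> 'e2 topology \<Rightarrow> ('e2 \<Rightarrow> 'a) \<Rightarrow> bool" where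
  "equivalent_maps E1 p1 E2 p2 \<longleftrightarrow>
     (\<exists>h. homeomorphic_map E1 E2 h \<and> (\<forall>e \<in> topspace E1. p2 (h e) = p1 e))"

definition simple_weak_equivalence :: "'a topology \<Rightarrow> 'e1 topology \<Rightarrow> ('e1 \<Rightarrow> 'a) \<Rightarrow>
    'e2 topology \<Rightarrow> ('e2 \<Rightarrow> 'a) \<Rightarrow> 'e3 topology \<Rightarrow> ('e3 \<Rightarrow> 'a) \<Rightarrow> ('e3 \<Rightarrow> 'e1) \<Rightarrow> ('e3 \<Rightarrow> 'e2) \<Rightarrow> bool" where
  "simple_weak_equivalence X E1 p1 E2 p2 E3 p3 f1 f2 \<longleftrightarrow>
     path_covering_map E1 X p1 \<and> path_covering_map E2 X p2 \<and> path_covering_map E3 X p3 \<and>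
     weak_homotopy_equivalence E3 E1 f1 \<and> weak_homotopy_equivalence E3 E2 f2 \<and>
     (\<forall>e \<in> topspace E3. p1 (f1 e) = p3 e) \<and> (\<forall>e \<in> topspace E3. p2 (f2 e) = p3 e)"

definition simply_weakly_equivalent :: "'a topology \<Rightarrow> 'e1 topology \<Rightarrow> ('e1 \<Rightarrow> 'a) \<Rightarrow>
    'e2 topology \<Rightarrow> ('e2 \<Rightarrow> 'a) \<Rightarrow> bool" where
  "simply_weakly_equivalent X E1 p1 E2 p2 \<longleftrightarrow>
     (\<exists>(E3 :: (real \<Rightarrow> 'a) set topology) p3 f1 f2.
        simple_weak_equivalence X E1 p1 E2 p2 E3 p3 f1 f2)"

text \<open>A chain of simple weak equivalences with at least one step; the chain without steps is
  subsumed because \<^const>\<open>simply_weakly_equivalent\<close> is reflexive on path-covering maps (take for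
  \<open>E3\<close> a homeomorphic copy of the total space, cf. \<open>path_covering_map_inject\<close>). The two ends may
  have total spaces of different types, hence the special treatment of the first and last step.\<close>

definition weakly_equivalent :: "'a topology \<Rightarrow> 'e1 topology \<Rightarrow> ('e1 \<Rightarrow> 'a) \<Rightarrow>
    'e2 topology \<Rightarrow> ('e2 \<Rightarrow> 'a) \<Rightarrow> bool" where
  "weakly_equivalent X E1 p1 E2 p2 \<longleftrightarrow>
     simply_weakly_equivalent X E1 p1 E2 p2 \<or>
     (\<exists>(F :: (real \<Rightarrow> 'a) set topology) q (G :: (real \<Rightarrow> 'a) set topology) r.
        simply_weakly_equivalent X E1 p1 F q \<and>
        (\<lambda>(F, q) (G, r). simply_weakly_equivalent X F q G r)\<^sup>*\<^sup>* (F, q) (G, r) \<and>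
        simply_weakly_equivalent X G r E2 p2)"

end

theory Submission
  imports Defs
begin

text \<open>The total space for \<open>H\<close> is the space of paths from \<open>x0\<close> modulo \<open>\<alpha> \<sim> \<beta>\<close> iff \<open>\<alpha>\<close> and \<open>\<beta>\<close> have the
  same endpoint and \<open>[\<alpha> \<cdot> \<beta>\<^sup>-] \<in> H\<close>, with the quotient topology. Paths lift to it continuously by
  concatenating with initial segments. Two lifts of the same path differ by a path in the coset
  space of \<open>H\<close>, so lifts are unique if that space is totally path-disconnected; conversely the coset
  space injects continuously into a fibre, and fibres contain only constant paths. Sending the
  class of \<open>\<alpha>\<close> to the endpoint of its lift is a continuous bijection onto any total space that
  realizes \<open>H\<close>, and a homeomorphism if \<open>ev\<^sub>1\<close> is a quotient map there. Maps from a contractible space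
  (a cube, a homotopy of cubes) lift back through this bijection, being families of paths issuing
  from one point, so it is a weak homotopy equivalence.\<close>

section \<open>Paths and the compact-open topology\<close>

text \<open>Path homotopy is encoded as lying in one path component of a space of paths with fixed
  ends. Together with the exponential law for the interval, this turns congruence and naturality of
  homotopies into the fact that continuous maps preserve path components. The obstacle is uniqueness
  of lifts to the space of classes: a path of classes does not come with a continuous choice of
  representatives, so it cannot be compared directly with a lift built from initial segments. The
  comparison is made on all pairs of a time and a representative and is then pushed down to classes;
  this is possible because the product of a quotient map with the interval is again a quotient map.
  The topology of a total space is constrained only through its paths, so the inverse of the
  comparison bijection is not known to be continuous. This is why uniqueness holds only up to weak
  equivalence unless evaluation at 1 is a quotient map.\<close>

lemma continuous_map_curry:
  assumes g: "continuous_map (prod_topology A Z) Y (\<lambda>(a, z). g z a)"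
  shows "continuous_map Z (compact_open_topology A Y) (\<lambda>z. restrict (g z) (topspace A))"
proof -
  have slice: "continuous_map A Y (restrict (g z) (topspace A))" if "z \<in> topspace Z" for z
  proof (rule continuous_map_eq)
    show "continuous_map A Y ((\<lambda>(a, z). g z a) \<circ> (\<lambda>a. (a, z)))"
      using that by (intro continuous_map_compose[OF _ g]) (simp add: continuous_map_pairedI)
  qed simp
  \<comment> \<open>The \<open>z\<close> for which \<open>g z\<close> sends \<open>K\<close> into
    \<open>U\<close> form the complement of the projection to \<open>Z\<close> of a closed subset of
    the product of \<open>K\<close> and \<open>Z\<close>; projecting away a compact factor is a
    closed map.\<close>
  have pre: "openin Z {z \<in> topspace Z. g z ` K \<subseteq> U}" if K: "compactin A K" and U: "openin Y U" for K U
  proof -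
    let ?P = "prod_topology (subtopology A K) Z"
    have KA: "K \<subseteq> topspace A"
      using K by (rule compactin_subset_topspace)
    have "continuous_map ?P Y (\<lambda>(a, z). g z a)"
      using continuous_map_from_subtopology[OF g, of "K \<times> topspace Z"]
      by (simp add: subtopology_Times)
    then have "closedin ?P {x \<in> topspace ?P. (\<lambda>(a, z). g z a) x \<in> topspace Y - U}"
      using U by (intro closedin_continuous_map_preimage) auto
    moreover have "closed_map ?P Z snd"
      using K by (intro closed_map_snd) (simp add: compact_space_subtopology)
    ultimately have cl: "closedin Z (snd ` {x \<in> topspace ?P. (\<lambda>(a, z). g z a) x \<in> topspace Y - U})"
      unfolding closed_map_def by blast
    have "topspace Z - snd ` {x \<in> topspace ?P. (\<lambda>(a, z). g z a) x \<in> topspace Y - U} =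
        {z \<in> topspace Z. g z ` K \<subseteq> U}"
    proof -
      have "g z a \<in> topspace Y" if "z \<in> topspace Z" "a \<in> K" for z a
        using continuous_map_image_subset_topspace[OF g] that KA by fastforce
      then show ?thesis
        using KA by (force simp: image_iff)
    qed
    then show ?thesis
      using openin_diff[OF openin_topspace cl] by simp
  qed
  show ?thesis
    unfolding compact_open_topology_def
  proof (rule continuous_on_generated_topo)
    fix W
    assume "W \<in> {{f \<in> extensional (topspace A). continuous_map A Y f \<and> f ` K \<subseteq> U} | K U.
        compactin A K \<and> openin Y U}"
    then obtain K U where W: "W = {f \<in> extensional (topspace A). continuous_map A Y f \<and> f ` K \<subseteq> U}"
      and K: "compactin A K" and U: "openin Y U" by blast
    have "restrict (g z) (topspace A) ` K = g z ` K" for z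
      using compactin_subset_topspace[OF K] by force
    then have "(\<lambda>z. restrict (g z) (topspace A)) -` W \<inter> topspace Z = {z \<in> topspace Z. g z ` K \<subseteq> U}"
      unfolding W using slice by auto
    then show "openin Z ((\<lambda>z. restrict (g z) (topspace A)) -` W \<inter> topspace Z)"
      using pre[OF K U] by simp
  next
    show "(\<lambda>z. restrict (g z) (topspace A)) ` topspace Z \<subseteq>
       \<Union>{{f \<in> extensional (topspace A). continuous_map A Y f \<and> f ` K \<subseteq> U} | K U.
        compactin A K \<and> openin Y U}"
    proof (rule image_subsetI)
      fix z assume "z \<in> topspace Z"
      then have "restrict (g z) (topspace A) \<in> topspace (compact_open_topology A Y)"
        using slice by (simp add: topspace_compact_open_topology)
      then show "restrict (g z) (topspace A) \<in>
         \<Union>{{f \<in> extensional (topspace A). continuous_map A Y f \<and> f ` K \<subseteq> U} | K U.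
          compactin A K \<and> openin Y U}"
        by (simp add: compact_open_topology_def topology_generated_by_topspace)
    qed
  qed
qed

text \<open>Local compactness supplies, inside the open preimage of \<open>U\<close> under
  \<open>f\<close>, a compact neighbourhood \<open>K\<close> of \<open>a\<close>. The functions
  sending \<open>K\<close> into \<open>U\<close> are an open neighbourhood of \<open>f\<close> that
  works for all points near \<open>a\<close> at once.\<close>

lemma continuous_map_evaluation:
  assumes "locally_compact_space A" and "Hausdorff_space A"
  shows "continuous_map (prod_topology A (compact_open_topology A Y)) Y (\<lambda>(a, f). f a)"
  unfolding continuous_map_def
proof (intro conjI allI impI)
  show "(\<lambda>(a, f). f a) \<in> topspace (prod_topology A (compact_open_topology A Y)) \<rightarrow> topspace Y"
    by (auto simp: topspace_compact_open_topology continuous_map_def)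
  fix U assume U: "openin Y U"
  let ?W = "{x \<in> topspace (prod_topology A (compact_open_topology A Y)). (case x of (a, f) \<Rightarrow> f a) \<in> U}"
  show "openin (prod_topology A (compact_open_topology A Y)) ?W"
    unfolding openin_prod_topology_alt
  proof (intro allI impI)
    fix a f assume "(a, f) \<in> ?W"
    then have a: "a \<in> topspace A" and f: "f \<in> extensional (topspace A)" "continuous_map A Y f"
      and fa: "f a \<in> U"
      by (auto simp: topspace_compact_open_topology)
    have "openin A {b \<in> topspace A. f b \<in> U}"
      using f(2) U by (auto simp: continuous_map_def)
    then obtain V K where V: "openin A V" and K: "compactin A K" and "a \<in> V" "V \<subseteq> K"
      and KU: "K \<subseteq> {b \<in> topspace A. f b \<in> U}"
      using assms(1) a fa
      unfolding locally_compact_space_neighbourhood_base[OF disjI1[OF assms(2)]] neighbourhood_base_of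
      by (metis (mono_tags, lifting) mem_Collect_eq)
    let ?B = "{h \<in> extensional (topspace A). continuous_map A Y h \<and> h ` K \<subseteq> U}"
    have "openin (compact_open_topology A Y) ?B"
      unfolding compact_open_topology_def using K U by (intro topology_generated_by_Basis) blast
    moreover have "f \<in> ?B"
      using f KU by auto
    moreover have "V \<times> ?B \<subseteq> ?W"
      using \<open>V \<subseteq> K\<close> openin_subset[OF V] by (auto simp: topspace_compact_open_topology)
    ultimately show "\<exists>V B. openin A V \<and> openin (compact_open_topology A Y) B \<and> a \<in> V \<and> f \<in> B \<and> V \<times> B \<subseteq> ?W"
      using V \<open>a \<in> V\<close> by blast
  qed
qed

section \<open>Continuity of the operations on paths\<close>

abbreviation free_paths :: "'a topology \<Rightarrow> (real \<Rightarrow> 'a) topology" where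
  "free_paths X \<equiv> compact_open_topology unit_interval X"

text \<open>A path in this space is a homotopy relative to the end points, so
  \<open>path_component_of (paths_between X a b)\<close> serves throughout as the homotopy
  relation.\<close>

definition paths_between :: "'a topology \<Rightarrow> 'a \<Rightarrow> 'a \<Rightarrow> (real \<Rightarrow> 'a) topology" where
  "paths_between X a b = subtopology (free_paths X) {\<alpha>. \<alpha> 0 = a \<and> \<alpha> 1 = b}"

lemma topspace_free_paths: "topspace (free_paths X) = {\<alpha> \<in> extensional {0..1}. pathin X \<alpha>}"
  by (simp add: topspace_compact_open_topology pathin_def)

lemma topspace_paths_between:
  "topspace (paths_between X a b) = {\<alpha> \<in> extensional {0..1}. pathin X \<alpha> \<and> \<alpha> 0 = a \<and> \<alpha> 1 = b}"
  by (auto simp: paths_between_def topspace_free_paths)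

lemma loop_space_eq: "loop_space X x = paths_between X x x"
  by (simp add: loop_space_def paths_between_def)

lemma topspace_unit_interval: "topspace unit_interval = {0..1}"
  by simp

lemma pathin_restrict: "pathin X (restrict g {0..1}) \<longleftrightarrow> pathin X g"
  unfolding pathin_def by (auto elim!: continuous_map_eq)

lemma pathin_in_topspace: "pathin X g \<Longrightarrow> t \<in> {0..1} \<Longrightarrow> g t \<in> topspace X"
  unfolding pathin_def continuous_map_def by auto

text \<open>One half of the exponential law for the interval;
  \<open>continuous_map_into_free_paths\<close> is the other. The operations on paths are shown to
  be continuous by evaluating with the first and currying with the second.\<close>

lemma continuous_map_eval_path:
  assumes "continuous_map Z (free_paths X) f" and "continuous_map Z unit_interval u"
  shows "continuous_map Z X (\<lambda>z. f z (u z))"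
proof -
  have "locally_compact_space unit_interval"
    by (rule compact_imp_locally_compact_space) (simp add: compact_space_subtopology)
  moreover have "Hausdorff_space unit_interval"
    by (simp add: Hausdorff_space_subtopology)
  ultimately have "continuous_map (prod_topology unit_interval (free_paths X)) X (\<lambda>(a, f). f a)"
    by (rule continuous_map_evaluation)
  moreover have "continuous_map Z (prod_topology unit_interval (free_paths X)) (\<lambda>z. (u z, f z))"
    using assms by (intro continuous_map_pairedI)
  ultimately have "continuous_map Z X ((\<lambda>(a, f). f a) \<circ> (\<lambda>z. (u z, f z)))"
    by (rule continuous_map_compose[rotated])
  then show ?thesis
    by (simp add: o_def)
qed

lemma continuous_map_into_free_paths:
  assumes "continuous_map (prod_topology unit_interval Z) X (\<lambda>w. g (snd w) (fst w))"
  shows "continuous_map Z (free_paths X) (\<lambda>z. restrict (g z) {0..1})"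
  using continuous_map_curry[of unit_interval Z X g] assms by (simp add: case_prod_unfold)

lemma continuous_map_into_unit_interval:
  "continuous_map Z unit_interval u \<longleftrightarrow>
     continuous_map Z euclideanreal u \<and> (\<forall>z\<in>topspace Z. 0 \<le> u z \<and> u z \<le> 1)"
  by (auto simp: continuous_map_in_subtopology image_subset_iff)

lemma continuous_map_reparametrize:
  assumes f: "continuous_map Z (free_paths X) f"
    and u: "continuous_map (prod_topology unit_interval Z) unit_interval (\<lambda>w. u (snd w) (fst w))"
  shows "continuous_map Z (free_paths X) (\<lambda>z. restrict (\<lambda>t. f z (u z t)) {0..1})"
  using continuous_map_eval_path[OF continuous_map_compose[OF continuous_map_snd f] u]
  by (intro continuous_map_into_free_paths) (simp add: o_def)

lemma continuous_map_compose_path: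
  assumes f: "continuous_map Z (free_paths X) f" and p: "continuous_map X Y p"
  shows "continuous_map Z (free_paths Y) (\<lambda>z. compose {0..1} p (f z))"
proof -
  have "continuous_map (prod_topology unit_interval Z) X (\<lambda>w. f (snd w) (fst w))"
    using continuous_map_eval_path[OF continuous_map_compose[OF continuous_map_snd f] continuous_map_fst]
    by (simp add: o_def)
  from continuous_map_compose[OF this p] show ?thesis
    unfolding compose_def by (intro continuous_map_into_free_paths) (simp add: o_def)
qed

definition rev_path :: "(real \<Rightarrow> 'a) \<Rightarrow> real \<Rightarrow> 'a" where
  "rev_path \<alpha> = restrict (\<lambda>t. \<alpha> (1 - t)) {0..1}"

definition trunc_path :: "real \<Rightarrow> (real \<Rightarrow> 'a) \<Rightarrow> real \<Rightarrow> 'a" where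
  "trunc_path s \<alpha> = restrict (\<lambda>t. \<alpha> (s * t)) {0..1}"

lemma continuous_map_rev_path:
  assumes "continuous_map Z (free_paths X) f"
  shows "continuous_map Z (free_paths X) (\<lambda>z. rev_path (f z))"
  unfolding rev_path_def
  by (rule continuous_map_reparametrize[OF assms])
    (auto simp: continuous_map_into_unit_interval intro!: continuous_intros
      continuous_map_into_fulltopology[OF continuous_map_fst])

lemma continuous_map_trunc_path:
  assumes f: "continuous_map Z (free_paths X) f" and u: "continuous_map Z unit_interval u"
  shows "continuous_map Z (free_paths X) (\<lambda>z. trunc_path (u z) (f z))"
  unfolding trunc_path_def
proof (rule continuous_map_reparametrize[OF f])
  have "continuous_map (prod_topology unit_interval Z) euclideanreal (\<lambda>w. u (snd w) * fst w)"
    using continuous_map_compose[OF continuous_map_snd u]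
    by (intro continuous_map_real_mult continuous_map_into_fulltopology[OF continuous_map_fst])
       (auto simp: o_def continuous_map_into_unit_interval)
  then show "continuous_map (prod_topology unit_interval Z) unit_interval (\<lambda>w. u (snd w) * fst w)"
    using u by (auto simp: continuous_map_into_unit_interval mult_le_one)
qed

lemma continuous_map_concat_loops:
  assumes f: "continuous_map Z (free_paths X) f" and g: "continuous_map Z (free_paths X) g"
    and eq: "\<And>z. z \<in> topspace Z \<Longrightarrow> f z 1 = g z 0"
  shows "continuous_map Z (free_paths X) (\<lambda>z. concat_loops (f z) (g z))"
  unfolding concat_loops_def
proof (rule continuous_map_into_free_paths)
  let ?P = "prod_topology unit_interval Z"
  have fst: "continuous_map ?P euclideanreal fst"
    by (rule continuous_map_into_fulltopology[OF continuous_map_fst])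
  \<comment> \<open>Covers both affine pieces: \<open>c = 0\<close> gives \<open>2 * t\<close> on
    the first half, \<open>c = 1\<close> gives \<open>2 * t - 1\<close> on the second.\<close>
  have lin: "continuous_map (subtopology ?P S) unit_interval (\<lambda>w. 2 * fst w - c)"
    if "\<And>w. w \<in> S \<Longrightarrow> w \<in> topspace ?P \<Longrightarrow> 0 \<le> 2 * fst w - c \<and> 2 * fst w - c \<le> 1" for S and c :: real
    using that by (auto simp: continuous_map_into_unit_interval
      intro!: continuous_intros continuous_map_from_subtopology[OF fst])
  show "continuous_map ?P X (\<lambda>w. if fst w \<le> 1/2 then f (snd w) (2 * fst w) else g (snd w) (2 * fst w - 1))"
  proof (rule continuous_map_cases_le[OF fst])
    show "continuous_map (subtopology ?P {w \<in> topspace ?P. fst w \<le> 1/2}) X (\<lambda>w. f (snd w) (2 * fst w))"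
      using continuous_map_eval_path[OF continuous_map_from_subtopology[OF continuous_map_compose[OF continuous_map_snd f]]
        lin[of "{w \<in> topspace ?P. fst w \<le> 1/2}" 0]]
      by (auto simp: o_def)
    show "continuous_map (subtopology ?P {w \<in> topspace ?P. 1/2 \<le> fst w}) X (\<lambda>w. g (snd w) (2 * fst w - 1))"
      using continuous_map_eval_path[OF continuous_map_from_subtopology[OF continuous_map_compose[OF continuous_map_snd g]]
        lin[of "{w \<in> topspace ?P. 1/2 \<le> fst w}" 1]]
      by (auto simp: o_def)
    show "f (snd w) (2 * fst w) = g (snd w) (2 * fst w - 1)" if "w \<in> topspace ?P" "fst w = 1/2" for w
    proof -
      have "2 * fst w = 1" "2 * fst w - 1 = 0"
        using that by simp_all
      then show ?thesis
        using eq[of "snd w"] that(1) by (simp only: mem_Times_iff topspace_prod_topology)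
    qed
  qed simp
qed

lemma concat_loops_0: "concat_loops \<alpha> \<beta> 0 = \<alpha> 0"
  and concat_loops_1: "concat_loops \<alpha> \<beta> 1 = \<beta> 1"
  by (simp_all add: concat_loops_def)

lemma rev_path_0: "rev_path \<alpha> 0 = \<alpha> 1" and rev_path_1: "rev_path \<alpha> 1 = \<alpha> 0"
  by (simp_all add: rev_path_def)

lemma trunc_path_0: "trunc_path s \<alpha> 0 = \<alpha> 0" and trunc_path_1: "trunc_path s \<alpha> 1 = \<alpha> s"
  by (simp_all add: trunc_path_def)

lemmas path_ends = concat_loops_0 concat_loops_1 rev_path_0 rev_path_1 trunc_path_0 trunc_path_1

lemma rev_path_rev_path: "\<alpha> \<in> extensional {0..1} \<Longrightarrow> rev_path (rev_path \<alpha>) = \<alpha>"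
  by (auto simp: rev_path_def fun_eq_iff extensional_def)

lemma compose_rev_path: "compose {0..1} p (rev_path \<alpha>) = rev_path (compose {0..1} p \<alpha>)"
  by (auto simp: rev_path_def compose_def fun_eq_iff)

lemma compose_concat_loops:
  "compose {0..1} p (concat_loops \<alpha> \<beta>) = concat_loops (compose {0..1} p \<alpha>) (compose {0..1} p \<beta>)"
  by (auto simp: concat_loops_def compose_def fun_eq_iff)

text \<open>Turns continuity of families into membership: applied to a constant family, it shows
  that a concatenation, reversal or initial segment of paths is again a path.\<close>

lemma continuous_map_const_in_topspace:
  "continuous_map unit_interval Y (\<lambda>_. c) \<Longrightarrow> c \<in> topspace Y"
  using continuous_map_image_subset_topspace[of unit_interval Y "\<lambda>_. c"]
  by (metis atLeastAtMost_iff image_subset_iff order_refl topspace_unit_interval zero_le_one)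

lemma concat_in_paths_between:
  assumes "\<alpha> \<in> topspace (paths_between X a b)" and "\<beta> \<in> topspace (paths_between X b c)"
  shows "concat_loops \<alpha> \<beta> \<in> topspace (paths_between X a c)"
proof -
  have "continuous_map unit_interval (free_paths X) (\<lambda>z. concat_loops \<alpha> \<beta>)"
    using assms by (intro continuous_map_concat_loops)
      (auto simp: topspace_paths_between topspace_free_paths)
  then have "concat_loops \<alpha> \<beta> \<in> topspace (free_paths X)"
    by (rule continuous_map_const_in_topspace)
  then show ?thesis
    using assms by (auto simp: topspace_paths_between topspace_free_paths path_ends)
qed

lemma rev_in_paths_between:
  assumes "\<alpha> \<in> topspace (paths_between X a b)"
  shows "rev_path \<alpha> \<in> topspace (paths_between X b a)"
proof -
  have "continuous_map unit_interval (free_paths X) (\<lambda>z. rev_path \<alpha>)"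
    using assms by (intro continuous_map_rev_path)
      (auto simp: topspace_paths_between topspace_free_paths)
  then have "rev_path \<alpha> \<in> topspace (free_paths X)"
    by (rule continuous_map_const_in_topspace)
  then show ?thesis
    using assms by (auto simp: topspace_paths_between topspace_free_paths path_ends)
qed

lemma trunc_in_paths_between:
  assumes "\<alpha> \<in> topspace (paths_between X a b)" and "s \<in> {0..1}"
  shows "trunc_path s \<alpha> \<in> topspace (paths_between X a (\<alpha> s))"
proof -
  have "continuous_map unit_interval (free_paths X) (\<lambda>z. trunc_path s \<alpha>)"
    using assms by (intro continuous_map_trunc_path)
      (auto simp: topspace_paths_between topspace_free_paths)
  then have "trunc_path s \<alpha> \<in> topspace (free_paths X)"
    by (rule continuous_map_const_in_topspace)
  then show ?thesis
    using assms by (auto simp: topspace_paths_between topspace_free_paths path_ends)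
qed

lemma const_in_paths_between:
  "a \<in> topspace X \<Longrightarrow> restrict (\<lambda>_. a) {0..1} \<in> topspace (paths_between X a a)"
  by (auto simp: topspace_paths_between pathin_restrict)

section \<open>Homotopies of paths\<close>

text \<open>The straight-line homotopy from \<phi> to \<psi> stays in the interval by convexity and
  is constant at both ends, where \<phi> and \<psi> agree.\<close>

lemma homotopic_reparametrizations:
  assumes \<gamma>: "\<gamma> \<in> topspace (free_paths X)"
    and \<phi>: "continuous_on {0..1} \<phi>" "\<And>t. t \<in> {0..1} \<Longrightarrow> \<phi> t \<in> {0..1}"
    and \<psi>: "continuous_on {0..1} \<psi>" "\<And>t. t \<in> {0..1} \<Longrightarrow> \<psi> t \<in> {0..1}"
    and ends: "\<phi> 0 = \<psi> 0" "\<phi> 1 = \<psi> 1"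
  shows "path_component_of (paths_between X (\<gamma> (\<phi> 0)) (\<gamma> (\<phi> 1)))
    (restrict (\<lambda>t. \<gamma> (\<phi> t)) {0..1}) (restrict (\<lambda>t. \<gamma> (\<psi> t)) {0..1})"
proof -
  define u where "u = (\<lambda>s t::real. (1 - s) * \<phi> t + s * \<psi> t)"
  define h where "h = (\<lambda>s. restrict (\<lambda>t. \<gamma> (u s t)) {0..1})"
  have "continuous_map unit_interval (free_paths X) h"
    unfolding h_def
  proof (rule continuous_map_reparametrize)
    show "continuous_map unit_interval (free_paths X) (\<lambda>_. \<gamma>)"
      using \<gamma> by simp
    have fst: "continuous_map (prod_topology unit_interval unit_interval) unit_interval fst"
      and snd: "continuous_map (prod_topology unit_interval unit_interval) unit_interval snd"
      by (rule continuous_map_fst continuous_map_snd)+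
    have 1: "continuous_map (prod_topology unit_interval unit_interval) euclideanreal (\<lambda>w. \<phi> (fst w))"
      and 2: "continuous_map (prod_topology unit_interval unit_interval) euclideanreal (\<lambda>w. \<psi> (fst w))"
      using continuous_map_compose[OF fst, of euclideanreal \<phi>]
        continuous_map_compose[OF fst, of euclideanreal \<psi>] \<phi>(1) \<psi>(1) by (simp_all add: o_def)
    have "u s t \<in> {0..1}" if "s \<in> {0..1}" "t \<in> {0..1}" for s t
    proof -
      have "convex {0..1::real}"
        by simp
      then show ?thesis
        unfolding u_def using that \<phi>(2)[of t] \<psi>(2)[of t]
        by (metis atLeastAtMost_iff convex_alt real_scaleR_def)
    qed
    then have "u (snd w) (fst w) \<in> {0..1}" if "w \<in> topspace (prod_topology unit_interval unit_interval)" for w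
      using that by auto
    moreover have "continuous_map (prod_topology unit_interval unit_interval) euclideanreal (\<lambda>w. u (snd w) (fst w))"
      unfolding u_def
      by (intro continuous_intros 1 2 continuous_map_into_fulltopology[OF snd])
    ultimately show "continuous_map (prod_topology unit_interval unit_interval) unit_interval
         (\<lambda>w. u (snd w) (fst w))"
      unfolding continuous_map_into_unit_interval by auto
  qed
  then have "pathin (paths_between X (\<gamma> (\<phi> 0)) (\<gamma> (\<phi> 1))) h"
    unfolding pathin_def paths_between_def
    by (rule continuous_map_into_subtopology) (auto simp: h_def u_def ends algebra_simps simp flip: distrib_left)
  moreover have "h 0 = restrict (\<lambda>t. \<gamma> (\<phi> t)) {0..1}" "h 1 = restrict (\<lambda>t. \<gamma> (\<psi> t)) {0..1}"
    by (simp_all add: h_def u_def)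
  ultimately show ?thesis
    unfolding path_component_of_def by blast
qed

text \<open>Reduces each groupoid law to exhibiting both of its sides as one path \<gamma> traversed
  in two ways.\<close>

lemma homotopic_reparametrizationsI:
  assumes "\<gamma> \<in> topspace (free_paths X)"
    and "continuous_on {0..1} \<phi>" "\<And>t. t \<in> {0..1} \<Longrightarrow> \<phi> t \<in> {0..1}"
    and "continuous_on {0..1} \<psi>" "\<And>t. t \<in> {0..1} \<Longrightarrow> \<psi> t \<in> {0..1}"
    and "\<phi> 0 = \<psi> 0" "\<phi> 1 = \<psi> 1"
    and "\<alpha> \<in> topspace (paths_between X a b)" and "\<And>t. t \<in> {0..1} \<Longrightarrow> \<alpha> t = \<gamma> (\<phi> t)"
    and "\<beta> \<in> extensional {0..1}" and "\<And>t. t \<in> {0..1} \<Longrightarrow> \<beta> t = \<gamma> (\<psi> t)"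
  shows "path_component_of (paths_between X a b) \<alpha> \<beta>"
proof -
  have "\<alpha> = restrict (\<lambda>t. \<gamma> (\<phi> t)) {0..1}" "\<beta> = restrict (\<lambda>t. \<gamma> (\<psi> t)) {0..1}"
    using assms(8-11) by (auto simp: fun_eq_iff topspace_paths_between extensional_def)
  moreover have "\<gamma> (\<phi> 0) = a" "\<gamma> (\<phi> 1) = b"
    using assms(8) assms(9)[of 0] assms(9)[of 1] by (auto simp: topspace_paths_between)
  ultimately show ?thesis
    using homotopic_reparametrizations[OF assms(1-7)] by simp
qed

lemma extensional_concat_loops: "concat_loops \<alpha> \<beta> \<in> extensional {0..1}"
  by (simp add: concat_loops_def)

lemma free_paths_if_between: "\<alpha> \<in> topspace (paths_between X a b) \<Longrightarrow> \<alpha> \<in> topspace (free_paths X)"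
  and extensional_if_between: "\<alpha> \<in> topspace (paths_between X a b) \<Longrightarrow> \<alpha> \<in> extensional {0..1}"
  by (simp_all add: topspace_paths_between topspace_free_paths)

text \<open>\<psi> maps [0,1/2], [1/2,3/4], [3/4,1] affinely onto [0,1/4], [1/4,1/2], [1/2,1]. Its
  slopes 1/2, 1, 2 increase, so it is convex and hence the maximum of its three affine pieces, a
  form in which continuity is immediate.\<close>

lemma homotopic_assoc:
  assumes "\<alpha> \<in> topspace (paths_between X a b)" and "\<beta> \<in> topspace (paths_between X b c)"
    and "\<gamma> \<in> topspace (paths_between X c d)"
  shows "path_component_of (paths_between X a d)
    (concat_loops (concat_loops \<alpha> \<beta>) \<gamma>) (concat_loops \<alpha> (concat_loops \<beta> \<gamma>))"
proof (rule homotopic_reparametrizationsI[where \<phi> = "\<lambda>t. t" and \<psi> = "\<lambda>t. max (t/2) (max (t - 1/4) (2 * t - 1))"])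
  show "concat_loops (concat_loops \<alpha> \<beta>) \<gamma> \<in> topspace (paths_between X a d)"
    by (rule concat_in_paths_between[OF concat_in_paths_between[OF assms(1,2)] assms(3)])
  then show "concat_loops (concat_loops \<alpha> \<beta>) \<gamma> \<in> topspace (free_paths X)"
    by (rule free_paths_if_between)
  show "concat_loops \<alpha> (concat_loops \<beta> \<gamma>) t =
      concat_loops (concat_loops \<alpha> \<beta>) \<gamma> (max (t/2) (max (t - 1/4) (2 * t - 1)))" if "t \<in> {0..1}" for t
  proof -
    have *: "concat_loops \<alpha> (concat_loops \<beta> \<gamma>) t =
      (if t \<le> 1/2 then \<alpha> (2 * t) else if t \<le> 3/4 then \<beta> (4 * t - 2) else \<gamma> (4 * t - 3))"
      using that by (auto simp: concat_loops_def algebra_simps)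
    have **: "concat_loops (concat_loops \<alpha> \<beta>) \<gamma> s =
      (if s \<le> 1/4 then \<alpha> (4 * s) else if s \<le> 1/2 then \<beta> (4 * s - 1) else \<gamma> (2 * s - 1))"
      if "s \<in> {0..1}" for s
      using that by (auto simp: concat_loops_def algebra_simps)
    consider "t \<le> 1/2" | "t > 1/2" "t \<le> 3/4" | "t > 3/4" by linarith
    then show ?thesis
    proof cases
      case 1
      then have "max (t/2) (max (t - 1/4) (2 * t - 1)) = t/2" by auto
      then show ?thesis using 1 that by (simp add: * **)
    next
      case 2
      then have "max (t/2) (max (t - 1/4) (2 * t - 1)) = t - 1/4" by auto
      then show ?thesis using 2 that by (simp add: * ** algebra_simps)
    next
      case 3
      then have "max (t/2) (max (t - 1/4) (2 * t - 1)) = 2 * t - 1" by auto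
      then show ?thesis using 3 that by (simp add: * ** algebra_simps)
    qed
  qed
qed (auto intro!: continuous_intros extensional_concat_loops simp: le_max_iff_disj)

lemma homotopic_left_unit:
  assumes "\<alpha> \<in> topspace (paths_between X a b)"
  shows "path_component_of (paths_between X a b) (concat_loops (restrict (\<lambda>_. a) {0..1}) \<alpha>) \<alpha>"
proof (rule homotopic_reparametrizationsI[where \<phi> = "\<lambda>t. max 0 (2 * t - 1)" and \<psi> = "\<lambda>t. t"])
  have "a \<in> topspace X"
    using assms by (force simp: topspace_paths_between dest: pathin_in_topspace[of _ _ 0])
  then show "concat_loops (restrict (\<lambda>_. a) {0..1}) \<alpha> \<in> topspace (paths_between X a b)"
    by (rule concat_in_paths_between[OF const_in_paths_between assms])
  show "concat_loops (restrict (\<lambda>_. a) {0..1}) \<alpha> t = \<alpha> (max 0 (2 * t - 1))" if "t \<in> {0..1}" for t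
  proof (cases "t \<le> 1/2")
    case True
    then have "max 0 (2 * t - 1) = 0" by auto
    then show ?thesis using True that assms by (simp add: concat_loops_def topspace_paths_between)
  next
    case False
    then have "max 0 (2 * t - 1) = 2 * t - 1" by auto
    then show ?thesis using False that by (simp add: concat_loops_def)
  qed
qed (use assms in \<open>auto intro!: continuous_intros dest: free_paths_if_between extensional_if_between\<close>)

lemma homotopic_right_unit:
  assumes "\<alpha> \<in> topspace (paths_between X a b)"
  shows "path_component_of (paths_between X a b) (concat_loops \<alpha> (restrict (\<lambda>_. b) {0..1})) \<alpha>"
proof (rule homotopic_reparametrizationsI[where \<phi> = "\<lambda>t. min 1 (2 * t)" and \<psi> = "\<lambda>t. t"])
  have "b \<in> topspace X"
    using assms by (force simp: topspace_paths_between dest: pathin_in_topspace[of _ _ 1])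
  then show "concat_loops \<alpha> (restrict (\<lambda>_. b) {0..1}) \<in> topspace (paths_between X a b)"
    by (rule concat_in_paths_between[OF assms const_in_paths_between])
  show "concat_loops \<alpha> (restrict (\<lambda>_. b) {0..1}) t = \<alpha> (min 1 (2 * t))" if "t \<in> {0..1}" for t
  proof (cases "t \<le> 1/2")
    case True
    then have "min 1 (2 * t) = 2 * t" by auto
    then show ?thesis using True that by (simp add: concat_loops_def)
  next
    case False
    then have "min 1 (2 * t) = 1" by auto
    then show ?thesis using False that assms by (simp add: concat_loops_def topspace_paths_between)
  qed
qed (use assms in \<open>auto intro!: continuous_intros dest: free_paths_if_between extensional_if_between\<close>)

text \<open>Going along \<alpha> and back is \<alpha> composed with a tent function, which vanishes
  at both ends and so contracts to the constant 0.\<close>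

lemma homotopic_right_inverse:
  assumes "\<alpha> \<in> topspace (paths_between X a b)"
  shows "path_component_of (paths_between X a a) (concat_loops \<alpha> (rev_path \<alpha>)) (restrict (\<lambda>_. a) {0..1})"
proof (rule homotopic_reparametrizationsI[where \<gamma> = \<alpha> and \<phi> = "\<lambda>t. min (2 * t) (2 - 2 * t)" and \<psi> = "\<lambda>t. 0"])
  show "\<alpha> \<in> topspace (free_paths X)"
    using assms by (rule free_paths_if_between)
  show "concat_loops \<alpha> (rev_path \<alpha>) \<in> topspace (paths_between X a a)"
    by (intro concat_in_paths_between[OF assms] rev_in_paths_between assms)
  show "concat_loops \<alpha> (rev_path \<alpha>) t = \<alpha> (min (2 * t) (2 - 2 * t))" if "t \<in> {0..1}" for t
    using that by (auto simp: concat_loops_def rev_path_def min_def)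
qed (use assms in \<open>auto intro!: continuous_intros simp: topspace_paths_between\<close>)

text \<open>Both sides run along \<open>concat_loops (rev_path \<beta>) \<delta>\<close>: the left
  one goes back from parameter 1/2 to 0, which traces \<beta>, and then forward to 1, whereas
  \<delta> alone is the stretch from 1/2 to 1.\<close>

lemma homotopic_cancel_left:
  assumes "\<beta> \<in> topspace (paths_between X b a)" and "\<delta> \<in> topspace (paths_between X b c)"
  shows "path_component_of (paths_between X b c) (concat_loops \<beta> (concat_loops (rev_path \<beta>) \<delta>)) \<delta>"
proof (rule homotopic_reparametrizationsI[where \<gamma> = "concat_loops (rev_path \<beta>) \<delta>"
      and \<phi> = "\<lambda>t. max (1/2 - t) (2 * t - 1)" and \<psi> = "\<lambda>t. 1/2 + t/2"])
  have *: "concat_loops (rev_path \<beta>) \<delta> \<in> topspace (paths_between X a c)"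
    by (intro concat_in_paths_between[OF _ assms(2)] rev_in_paths_between assms)
  then show "concat_loops (rev_path \<beta>) \<delta> \<in> topspace (free_paths X)"
    by (rule free_paths_if_between)
  show "concat_loops \<beta> (concat_loops (rev_path \<beta>) \<delta>) \<in> topspace (paths_between X b c)"
    by (intro concat_in_paths_between[OF _ *] assms)
  show "concat_loops \<beta> (concat_loops (rev_path \<beta>) \<delta>) t =
      concat_loops (rev_path \<beta>) \<delta> (max (1/2 - t) (2 * t - 1))" if "t \<in> {0..1}" for t
  proof (cases "t \<le> 1/2")
    case True
    then have "max (1/2 - t) (2 * t - 1) = 1/2 - t" by auto
    then show ?thesis using True that by (simp add: concat_loops_def rev_path_def algebra_simps)
  next
    case False
    then have "max (1/2 - t) (2 * t - 1) = 2 * t - 1" by auto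
    then show ?thesis using False that by (simp add: concat_loops_def[of \<beta>] rev_path_def)
  qed
  show "\<delta> t = concat_loops (rev_path \<beta>) \<delta> (1/2 + t/2)" if "t \<in> {0..1}" for t
    using that assms by (auto simp: concat_loops_def rev_path_def topspace_paths_between)
qed (use assms in \<open>auto intro!: continuous_intros dest: extensional_if_between\<close>)

text \<open>Both sides run along \<open>concat_loops \<alpha> (rev_path \<beta>)\<close>: the left
  one goes forward to parameter 1 and back to 1/2, the right one only forward to 1/2.\<close>

lemma homotopic_cancel_right:
  assumes "\<alpha> \<in> topspace (paths_between X a b)" and "\<beta> \<in> topspace (paths_between X c b)"
  shows "path_component_of (paths_between X a b) (concat_loops (concat_loops \<alpha> (rev_path \<beta>)) \<beta>) \<alpha>"
proof (rule homotopic_reparametrizationsI[where \<gamma> = "concat_loops \<alpha> (rev_path \<beta>)"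
      and \<phi> = "\<lambda>t. min (2 * t) (3/2 - t)" and \<psi> = "\<lambda>t. t/2"])
  have *: "concat_loops \<alpha> (rev_path \<beta>) \<in> topspace (paths_between X a c)"
    by (intro concat_in_paths_between[OF assms(1)] rev_in_paths_between assms)
  then show "concat_loops \<alpha> (rev_path \<beta>) \<in> topspace (free_paths X)"
    by (rule free_paths_if_between)
  show "concat_loops (concat_loops \<alpha> (rev_path \<beta>)) \<beta> \<in> topspace (paths_between X a b)"
    by (intro concat_in_paths_between[OF *] assms)
  show "concat_loops (concat_loops \<alpha> (rev_path \<beta>)) \<beta> t =
      concat_loops \<alpha> (rev_path \<beta>) (min (2 * t) (3/2 - t))" if "t \<in> {0..1}" for t
  proof (cases "t \<le> 1/2")
    case True
    then have "min (2 * t) (3/2 - t) = 2 * t" by auto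
    then show ?thesis using True that by (simp add: concat_loops_def[of _ \<beta>])
  next
    case False
    then have m: "min (2 * t) (3/2 - t) = 3/2 - t" by auto
    have "concat_loops (concat_loops \<alpha> (rev_path \<beta>)) \<beta> t = \<beta> (2 * t - 1)"
      using False that by (simp add: concat_loops_def[of _ \<beta>])
    \<comment> \<open>At \<open>t = 1\<close> the parameter is 1/2, where
      \<open>concat_loops\<close> takes its value from \<alpha>; the two formulas still agree there
      because \<alpha> and \<beta> both end at \<open>b\<close>.\<close>
    moreover have "concat_loops \<alpha> (rev_path \<beta>) (3/2 - t) = \<beta> (2 * t - 1)"
      using False that assms
      by (cases "t = 1") (auto simp: concat_loops_def rev_path_def topspace_paths_between algebra_simps)
    ultimately show ?thesis by (simp only: m)
  qed
  show "\<alpha> t = concat_loops \<alpha> (rev_path \<beta>) (t/2)" if "t \<in> {0..1}" for t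
    using that by (auto simp: concat_loops_def)
qed (use assms in \<open>auto intro!: continuous_intros dest: extensional_if_between\<close>)

lemma continuous_map_paths_between_free: "continuous_map (paths_between X a b) (free_paths X) (\<lambda>\<alpha>. \<alpha>)"
  unfolding paths_between_def using continuous_map_from_subtopology[OF continuous_map_id] by (simp add: id_def)

text \<open>Concatenation with a fixed path is a continuous map between spaces of paths, so it
  carries path components into path components.\<close>

lemma homotopic_concat_right:
  assumes "path_component_of (paths_between X a b) \<alpha> \<alpha>'" and "\<beta> \<in> topspace (paths_between X b c)"
  shows "path_component_of (paths_between X a c) (concat_loops \<alpha> \<beta>) (concat_loops \<alpha>' \<beta>)"
proof (rule path_component_of_continuous_image[OF _ assms(1)])
  have "continuous_map (paths_between X a b) (free_paths X) (\<lambda>\<alpha>. concat_loops \<alpha> \<beta>)"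
    by (rule continuous_map_concat_loops[OF continuous_map_paths_between_free])
      (use assms(2) in \<open>auto simp: topspace_paths_between topspace_free_paths\<close>)
  then show "continuous_map (paths_between X a b) (paths_between X a c) (\<lambda>\<alpha>. concat_loops \<alpha> \<beta>)"
    unfolding paths_between_def[of X a c] using assms(2)
    by (intro continuous_map_into_subtopology) (auto simp: topspace_paths_between path_ends)
qed

lemma homotopic_concat_left:
  assumes "\<alpha> \<in> topspace (paths_between X a b)" and "path_component_of (paths_between X b c) \<beta> \<beta>'"
  shows "path_component_of (paths_between X a c) (concat_loops \<alpha> \<beta>) (concat_loops \<alpha> \<beta>')"
proof (rule path_component_of_continuous_image[OF _ assms(2)])
  have "continuous_map (paths_between X b c) (free_paths X) (\<lambda>\<beta>. concat_loops \<alpha> \<beta>)"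
    by (rule continuous_map_concat_loops[OF _ continuous_map_paths_between_free])
      (use assms(1) in \<open>auto simp: topspace_paths_between topspace_free_paths\<close>)
  then show "continuous_map (paths_between X b c) (paths_between X a c) (\<lambda>\<beta>. concat_loops \<alpha> \<beta>)"
    unfolding paths_between_def[of X a c] using assms(1)
    by (intro continuous_map_into_subtopology) (auto simp: topspace_paths_between path_ends)
qed

lemma homotopic_concat:
  assumes "path_component_of (paths_between X a b) \<alpha> \<alpha>'" and "path_component_of (paths_between X b c) \<beta> \<beta>'"
  shows "path_component_of (paths_between X a c) (concat_loops \<alpha> \<beta>) (concat_loops \<alpha>' \<beta>')"
proof -
  have "\<alpha>' \<in> topspace (paths_between X a b)" "\<beta> \<in> topspace (paths_between X b c)"
    using assms by (simp_all add: path_component_in_topspace)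
  then show ?thesis
    using path_component_of_trans[OF homotopic_concat_right[OF assms(1)] homotopic_concat_left[OF _ assms(2)]]
    by simp
qed

lemma homotopic_compose:
  assumes "path_component_of (paths_between E a b) \<alpha> \<beta>" and p: "continuous_map E X p"
  shows "path_component_of (paths_between X (p a) (p b)) (compose {0..1} p \<alpha>) (compose {0..1} p \<beta>)"
proof (rule path_component_of_continuous_image[OF _ assms(1)])
  show "continuous_map (paths_between E a b) (paths_between X (p a) (p b)) (compose {0..1} p)"
    unfolding paths_between_def[of X "p a"]
    using continuous_map_compose_path[OF continuous_map_paths_between_free p, of a b]
    unfolding compose_def
    by (intro continuous_map_into_subtopology) (auto simp: topspace_paths_between compose_def)
qed

section \<open>The fundamental group\<close>

text \<open>By the exponential law a homotopy of loops is a path in the loop space. Values outside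
  the interval cause no discrepancy because loops are extensional.\<close>

lemma loop_homotopy_eq:
  "(\<alpha>, \<beta>) \<in> loop_homotopy X x \<longleftrightarrow> path_component_of (loop_space X x) \<alpha> \<beta>"
proof
  assume "(\<alpha>, \<beta>) \<in> loop_homotopy X x"
  then have \<alpha>: "\<alpha> \<in> topspace (loop_space X x)" and \<beta>: "\<beta> \<in> topspace (loop_space X x)"
    and "homotopic_with (\<lambda>\<gamma>. \<gamma> 0 = x \<and> \<gamma> 1 = x) unit_interval X \<alpha> \<beta>"
    by (auto simp: loop_homotopy_def)
  then obtain h where h: "continuous_map (prod_topology unit_interval unit_interval) X h"
    and h01: "\<And>t. h (0, t) = \<alpha> t" "\<And>t. h (1, t) = \<beta> t"
    and ends: "\<And>s. s \<in> {0..1} \<Longrightarrow> h (s, 0) = x \<and> h (s, 1) = x"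
    unfolding homotopic_with_def by blast
  define k where "k = (\<lambda>s. restrict (\<lambda>t. h (s, t)) {0..1})"
  have "continuous_map unit_interval (free_paths X) k"
    unfolding k_def
  proof (rule continuous_map_into_free_paths)
    have "continuous_map (prod_topology unit_interval unit_interval) X (h \<circ> (\<lambda>w. (snd w, fst w)))"
      by (rule continuous_map_compose[OF _ h]) (intro continuous_map_pairedI continuous_map_fst continuous_map_snd)
    then show "continuous_map (prod_topology unit_interval unit_interval) X (\<lambda>w. h (snd w, fst w))"
      by (simp add: o_def)
  qed
  then have "pathin (loop_space X x) k"
    unfolding pathin_def loop_space_def using ends
    by (intro continuous_map_into_subtopology) (auto simp: k_def)
  moreover have "k 0 = \<alpha>" "k 1 = \<beta>"
    using \<alpha> \<beta> by (auto simp: k_def h01 topspace_loop_space fun_eq_iff extensional_def)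
  ultimately show "path_component_of (loop_space X x) \<alpha> \<beta>"
    unfolding path_component_of_def by blast
next
  assume pc: "path_component_of (loop_space X x) \<alpha> \<beta>"
  then have \<alpha>: "\<alpha> \<in> topspace (loop_space X x)" and \<beta>: "\<beta> \<in> topspace (loop_space X x)"
    by (auto dest: path_component_in_topspace)
  obtain k where k: "continuous_map unit_interval (loop_space X x) k" and k01: "k 0 = \<alpha>" "k 1 = \<beta>"
    using pc unfolding path_component_of_def pathin_def by blast
  have kf: "continuous_map unit_interval (free_paths X) k"
    using k unfolding loop_space_def by (rule continuous_map_into_fulltopology)
  have "continuous_map (prod_topology unit_interval unit_interval) X (\<lambda>w. k (fst w) (snd w))"
    using continuous_map_eval_path[OF continuous_map_compose[OF continuous_map_fst kf] continuous_map_snd]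
    by (simp add: o_def)
  moreover have "k s 0 = x \<and> k s 1 = x" if "s \<in> {0..1}" for s
    using continuous_map_image_subset_topspace[OF k] that by (auto simp: topspace_loop_space image_subset_iff)
  ultimately have "homotopic_with (\<lambda>\<gamma>. \<gamma> 0 = x \<and> \<gamma> 1 = x) unit_interval X \<alpha> \<beta>"
    unfolding homotopic_with_def
    by (intro exI[of _ "\<lambda>w. k (fst w) (snd w)"]) (simp add: k01)
  then show "(\<alpha>, \<beta>) \<in> loop_homotopy X x"
    using \<alpha> \<beta> by (simp add: loop_homotopy_def)
qed

lemma loop_class_eq: "loop_class X x \<alpha> = path_component_of_set (loop_space X x) \<alpha>"
  by (auto simp: loop_class_def loop_homotopy_eq)

lemma loop_class_eq_iff:
  assumes "\<alpha> \<in> topspace (loop_space X x)"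
  shows "loop_class X x \<alpha> = loop_class X x \<beta> \<longleftrightarrow> path_component_of (loop_space X x) \<alpha> \<beta>"
proof
  assume "loop_class X x \<alpha> = loop_class X x \<beta>"
  moreover have "\<alpha> \<in> loop_class X x \<alpha>"
    using assms by (simp add: loop_class_eq path_component_of_refl)
  ultimately show "path_component_of (loop_space X x) \<alpha> \<beta>"
    by (simp add: loop_class_eq path_component_of_sym)
next
  assume "path_component_of (loop_space X x) \<alpha> \<beta>"
  then show "loop_class X x \<alpha> = loop_class X x \<beta>"
    unfolding loop_class_eq by (blast intro: path_component_of_sym path_component_of_trans)
qed

lemma const_loop: "x \<in> topspace X \<Longrightarrow> restrict (\<lambda>_. x) {0..1} \<in> topspace (loop_space X x)"
  by (simp add: loop_space_eq const_in_paths_between)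

lemma concat_loop:
  "\<alpha> \<in> topspace (loop_space X x) \<Longrightarrow> \<beta> \<in> topspace (loop_space X x) \<Longrightarrow>
   concat_loops \<alpha> \<beta> \<in> topspace (loop_space X x)"
  unfolding loop_space_eq by (rule concat_in_paths_between)

lemma rev_loop: "\<alpha> \<in> topspace (loop_space X x) \<Longrightarrow> rev_path \<alpha> \<in> topspace (loop_space X x)"
  unfolding loop_space_eq by (rule rev_in_paths_between)

lemma carrier_fundamental_group:
  "carrier (fundamental_group X x) = loop_class X x ` topspace (loop_space X x)"
  and one_fundamental_group:
  "\<one>\<^bsub>fundamental_group X x\<^esub> = loop_class X x (restrict (\<lambda>_. x) {0..1})"
  by (simp_all add: fundamental_group_def)

text \<open>All sets in the defining union coincide, since homotopic factors have homotopic
  concatenations, and the union runs over a non-empty family.\<close>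

lemma mult_fundamental_group:
  assumes "\<alpha> \<in> topspace (loop_space X x)" and "\<beta> \<in> topspace (loop_space X x)"
  shows "loop_class X x \<alpha> \<otimes>\<^bsub>fundamental_group X x\<^esub> loop_class X x \<beta> = loop_class X x (concat_loops \<alpha> \<beta>)"
proof -
  have *: "loop_class X x (concat_loops \<alpha>' \<beta>') = loop_class X x (concat_loops \<alpha> \<beta>)"
    if "\<alpha>' \<in> loop_class X x \<alpha>" "\<beta>' \<in> loop_class X x \<beta>" for \<alpha>' \<beta>'
    using homotopic_concat[of X x x \<alpha> \<alpha>' x \<beta> \<beta>'] that loop_class_eq_iff[OF concat_loop[OF assms]]
    by (auto simp: loop_class_eq loop_space_eq)
  have "(\<Union>\<alpha>'\<in>loop_class X x \<alpha>. \<Union>\<beta>'\<in>loop_class X x \<beta>. loop_class X x (concat_loops \<alpha>' \<beta>')) =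
      (\<Union>\<alpha>'\<in>loop_class X x \<alpha>. \<Union>\<beta>'\<in>loop_class X x \<beta>. loop_class X x (concat_loops \<alpha> \<beta>))"
    by (intro SUP_cong refl *)
  also have "\<dots> = loop_class X x (concat_loops \<alpha> \<beta>)"
  proof -
    have "\<alpha> \<in> loop_class X x \<alpha>" "\<beta> \<in> loop_class X x \<beta>"
      using assms by (simp_all add: loop_class_eq path_component_of_refl)
    then show ?thesis by blast
  qed
  finally show ?thesis
    by (simp add: fundamental_group_def)
qed

lemma fundamental_group_right_inverse:
  assumes "\<alpha> \<in> topspace (loop_space X x)"
  shows "loop_class X x \<alpha> \<otimes>\<^bsub>fundamental_group X x\<^esub> loop_class X x (rev_path \<alpha>) = \<one>\<^bsub>fundamental_group X x\<^esub>"
  using homotopic_right_inverse[of \<alpha> X x x] assms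
  by (simp add: mult_fundamental_group rev_loop one_fundamental_group loop_class_eq_iff concat_loop loop_space_eq[symmetric])

lemma fundamental_group_left_inverse:
  assumes "\<alpha> \<in> topspace (loop_space X x)"
  shows "loop_class X x (rev_path \<alpha>) \<otimes>\<^bsub>fundamental_group X x\<^esub> loop_class X x \<alpha> = \<one>\<^bsub>fundamental_group X x\<^esub>"
  using fundamental_group_right_inverse[OF rev_loop[OF assms]] assms
  by (simp add: rev_path_rev_path topspace_loop_space)

lemma group_fundamental_group:
  assumes "x \<in> topspace X"
  shows "group (fundamental_group X x)"
proof (rule groupI)
  let ?G = "fundamental_group X x"
  show "\<one>\<^bsub>?G\<^esub> \<in> carrier ?G"
    using assms by (simp add: carrier_fundamental_group one_fundamental_group const_loop)
  fix A assume "A \<in> carrier ?G"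
  then obtain \<alpha> where A: "A = loop_class X x \<alpha>" and \<alpha>: "\<alpha> \<in> topspace (loop_space X x)"
    by (auto simp: carrier_fundamental_group)
  show "\<one>\<^bsub>?G\<^esub> \<otimes>\<^bsub>?G\<^esub> A = A"
    using homotopic_left_unit[of \<alpha> X x x] assms \<alpha>
    by (simp add: A one_fundamental_group mult_fundamental_group const_loop loop_class_eq_iff concat_loop loop_space_eq[symmetric])
  show "\<exists>B\<in>carrier ?G. B \<otimes>\<^bsub>?G\<^esub> A = \<one>\<^bsub>?G\<^esub>"
    using fundamental_group_left_inverse[OF \<alpha>] rev_loop[OF \<alpha>] by (auto simp: A carrier_fundamental_group)
  fix B assume "B \<in> carrier ?G"
  then obtain \<beta> where B: "B = loop_class X x \<beta>" and \<beta>: "\<beta> \<in> topspace (loop_space X x)"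
    by (auto simp: carrier_fundamental_group)
  show "A \<otimes>\<^bsub>?G\<^esub> B \<in> carrier ?G"
    using \<alpha> \<beta> by (simp add: A B mult_fundamental_group carrier_fundamental_group concat_loop)
  fix C assume "C \<in> carrier ?G"
  then obtain \<gamma> where C: "C = loop_class X x \<gamma>" and \<gamma>: "\<gamma> \<in> topspace (loop_space X x)"
    by (auto simp: carrier_fundamental_group)
  show "A \<otimes>\<^bsub>?G\<^esub> B \<otimes>\<^bsub>?G\<^esub> C = A \<otimes>\<^bsub>?G\<^esub> (B \<otimes>\<^bsub>?G\<^esub> C)"
    using homotopic_assoc[of \<alpha> X x x \<beta> x \<gamma> x] \<alpha> \<beta> \<gamma>
    by (simp add: A B C mult_fundamental_group concat_loop loop_class_eq_iff loop_space_eq[symmetric])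
qed

lemma inv_fundamental_group:
  assumes "\<alpha> \<in> topspace (loop_space X x)"
  shows "inv\<^bsub>fundamental_group X x\<^esub> loop_class X x \<alpha> = loop_class X x (rev_path \<alpha>)"
proof -
  have "x \<in> topspace X"
    using assms by (force simp: topspace_loop_space dest: pathin_in_topspace[of _ _ 0])
  then show ?thesis
    using fundamental_group_left_inverse[OF assms] rev_loop[OF assms] assms
    by (intro group.inv_equality[OF group_fundamental_group]) (auto simp: carrier_fundamental_group)
qed

text \<open>For right cosets the criterion is that A times the inverse of B lies in
  \<open>H\<close>, and the inverse of a class is the class of the reversed loop. This fixes the
  order of the factors in all difference loops below.\<close>

lemma coset_eq_iff:
  assumes "subgroup H (fundamental_group X x)"
    and \<alpha>: "\<alpha> \<in> topspace (loop_space X x)" and \<beta>: "\<beta> \<in> topspace (loop_space X x)"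
  shows "H #>\<^bsub>fundamental_group X x\<^esub> loop_class X x \<alpha> = H #>\<^bsub>fundamental_group X x\<^esub> loop_class X x \<beta> \<longleftrightarrow>
    loop_class X x (concat_loops \<alpha> (rev_path \<beta>)) \<in> H"
proof -
  have "x \<in> topspace X"
    using assms by (force simp: topspace_loop_space dest: pathin_in_topspace[of _ _ 0])
  then interpret group "fundamental_group X x"
    by (rule group_fundamental_group)
  let ?G = "fundamental_group X x"
  have A: "loop_class X x \<alpha> \<in> carrier ?G" and B: "loop_class X x \<beta> \<in> carrier ?G"
    using \<alpha> \<beta> by (auto simp: carrier_fundamental_group)
  have "H #>\<^bsub>?G\<^esub> loop_class X x \<alpha> = H #>\<^bsub>?G\<^esub> loop_class X x \<beta> \<longleftrightarrow>
      loop_class X x \<alpha> \<otimes>\<^bsub>?G\<^esub> inv\<^bsub>?G\<^esub> loop_class X x \<beta> \<in> H"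
    unfolding subgroup.rcos_module[OF assms(1) is_group B A, symmetric]
    using rcos_self[OF A assms(1)] repr_independence[OF _ B assms(1), of "loop_class X x \<alpha>"] by auto
  then show ?thesis
    using \<alpha> \<beta> by (simp add: inv_fundamental_group mult_fundamental_group rev_loop)
qed

section \<open>Lifting paths\<close>

lemma continuous_map_path_space_free: "continuous_map (path_space X x) (free_paths X) (\<lambda>\<alpha>. \<alpha>)"
  unfolding path_space_def using continuous_map_from_subtopology[OF continuous_map_id] by (simp add: id_def)

lemma continuous_map_into_path_space:
  "continuous_map Z (path_space X x) f \<longleftrightarrow> continuous_map Z (free_paths X) f \<and> (\<forall>z\<in>topspace Z. f z 0 = x)"
  by (auto simp: path_space_def continuous_map_in_subtopology image_subset_iff)

lemma continuous_map_into_loop_space: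
  "continuous_map Z (loop_space X x) f \<longleftrightarrow>
     continuous_map Z (free_paths X) f \<and> (\<forall>z\<in>topspace Z. f z 0 = x \<and> f z 1 = x)"
  by (auto simp: loop_space_def continuous_map_in_subtopology image_subset_iff)

lemma continuous_map_ev1: "continuous_map (path_space X x) X (\<lambda>\<alpha>. \<alpha> 1)"
  by (rule continuous_map_eval_path[OF continuous_map_path_space_free]) simp

lemma paths_between_subset_path_space: "\<alpha> \<in> topspace (paths_between X a b) \<Longrightarrow> \<alpha> \<in> topspace (path_space X a)"
  by (simp add: topspace_paths_between topspace_path_space)

lemma path_space_paths_between:
  "\<alpha> \<in> topspace (path_space X a) \<longleftrightarrow> \<alpha> \<in> topspace (paths_between X a (\<alpha> 1))"
  by (simp add: topspace_paths_between topspace_path_space)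

text \<open>The inverse of the map that \<open>p\<close> induces on paths issuing from
  \<open>e\<close>; the covering property makes it a continuous inverse on all paths from
  \<open>p e\<close>.\<close>

definition path_lift :: "'e topology \<Rightarrow> ('e \<Rightarrow> 'a) \<Rightarrow> 'e \<Rightarrow> (real \<Rightarrow> 'a) \<Rightarrow> real \<Rightarrow> 'e" where
  "path_lift E p e = inv_into (topspace (path_space E e)) (compose {0..1} p)"

lemma homeomorphic_map_path_lift:
  assumes "has_continuous_path_covering E X p" and "e \<in> topspace E"
  shows "homeomorphic_maps (path_space E e) (path_space X (p e)) (compose {0..1} p) (path_lift E p e)"
proof -
  have h: "homeomorphic_map (path_space E e) (path_space X (p e)) (compose {0..1} p)"
    using assms by (simp add: has_continuous_path_covering_def)
  then obtain g where g: "homeomorphic_maps (path_space E e) (path_space X (p e)) (compose {0..1} p) g"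
    using homeomorphic_map_maps by blast
  have inj: "inj_on (compose {0..1} p) (topspace (path_space E e))"
    using h homeomorphic_imp_injective_map by blast
  have "path_lift E p e \<alpha> = g \<alpha>" if \<alpha>: "\<alpha> \<in> topspace (path_space X (p e))" for \<alpha>
  proof -
    have "g \<alpha> \<in> topspace (path_space E e)" "compose {0..1} p (g \<alpha>) = \<alpha>"
      using g \<alpha> continuous_map_image_subset_topspace unfolding homeomorphic_maps_def by blast+
    then show ?thesis
      unfolding path_lift_def using inv_into_f_f[OF inj] by metis
  qed
  then show ?thesis
    by (intro homeomorphic_maps_eq[OF g]) auto
qed

context
  fixes E :: "'e topology" and X :: "'a topology" and p :: "'e \<Rightarrow> 'a" and e :: 'e
  assumes cov: "has_continuous_path_covering E X p" and e: "e \<in> topspace E"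
begin

lemma covering_continuous: "continuous_map E X p"
  using cov by (simp add: has_continuous_path_covering_def)

lemma continuous_map_path_lift: "continuous_map (path_space X (p e)) (path_space E e) (path_lift E p e)"
  using homeomorphic_map_path_lift[OF cov e] by (simp add: homeomorphic_maps_def)

lemma path_lift_in: "\<alpha> \<in> topspace (path_space X (p e)) \<Longrightarrow> path_lift E p e \<alpha> \<in> topspace (path_space E e)"
  using continuous_map_image_subset_topspace[OF continuous_map_path_lift] by blast

lemma compose_path_lift: "\<alpha> \<in> topspace (path_space X (p e)) \<Longrightarrow> compose {0..1} p (path_lift E p e \<alpha>) = \<alpha>"
  using homeomorphic_map_path_lift[OF cov e] by (simp add: homeomorphic_maps_def)

lemma path_lift_compose: "\<gamma> \<in> topspace (path_space E e) \<Longrightarrow> path_lift E p e (compose {0..1} p \<gamma>) = \<gamma>"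
  using homeomorphic_map_path_lift[OF cov e] by (simp add: homeomorphic_maps_def)

lemma compose_in_path_space:
  "\<gamma> \<in> topspace (path_space E e) \<Longrightarrow> compose {0..1} p \<gamma> \<in> topspace (path_space X (p e))"
  using homeomorphic_map_path_lift[OF cov e] continuous_map_image_subset_topspace
  unfolding homeomorphic_maps_def by blast

lemma path_lift_ends:
  assumes "\<alpha> \<in> topspace (path_space X (p e))"
  shows "path_lift E p e \<alpha> 0 = e" and "p (path_lift E p e \<alpha> 1) = \<alpha> 1"
    and "path_lift E p e \<alpha> 1 \<in> topspace E"
proof -
  show "path_lift E p e \<alpha> 0 = e"
    using path_lift_in[OF assms] by (simp add: topspace_path_space)
  have "compose {0..1} p (path_lift E p e \<alpha>) 1 = \<alpha> 1"
    by (simp add: compose_path_lift[OF assms])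
  then show "p (path_lift E p e \<alpha> 1) = \<alpha> 1"
    by (simp add: compose_def)
  show "path_lift E p e \<alpha> 1 \<in> topspace E"
    using path_lift_in[OF assms] by (auto simp: topspace_path_space intro: pathin_in_topspace)
qed

end

text \<open>The path and the constant path at its start have the same projection, and paths in
  \<open>E\<close> with a given start are determined by their projections.\<close>

lemma path_in_fibre_constant:
  assumes cov: "has_continuous_path_covering E X p" and \<gamma>: "pathin E \<gamma>"
    and fibre: "\<And>t. t \<in> {0..1} \<Longrightarrow> p (\<gamma> t) = x" and t: "t \<in> {0..1}"
  shows "\<gamma> t = \<gamma> 0"
proof -
  let ?\<gamma> = "restrict \<gamma> {0..1}" and ?c = "restrict (\<lambda>_. \<gamma> 0) {0..1}"
  have 0: "\<gamma> 0 \<in> topspace E"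
    using \<gamma> by (rule pathin_in_topspace) simp
  have in_path_space: "?\<gamma> \<in> topspace (path_space E (\<gamma> 0))" "?c \<in> topspace (path_space E (\<gamma> 0))"
    using \<gamma> 0 by (auto simp: topspace_path_space pathin_restrict)
  moreover have "compose {0..1} p ?\<gamma> = compose {0..1} p ?c"
    using fibre by (auto simp: compose_def fun_eq_iff)
  ultimately have "?\<gamma> = ?c"
    using path_lift_compose[OF cov 0] by metis
  then show ?thesis
    using t by (metis restrict_apply')
qed

text \<open>While a path is deformed with fixed ends, the end point of its lift moves along a path
  in the fibre over \<open>b\<close>, and such a path is constant.\<close>

lemma path_lift_homotopic:
  assumes cov: "has_continuous_path_covering E X p" and e: "e \<in> topspace E"
    and hom: "path_component_of (paths_between X (p e) b) \<alpha> \<beta>"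
  shows "path_lift E p e \<alpha> 1 = path_lift E p e \<beta> 1"
proof -
  obtain h where h: "continuous_map unit_interval (paths_between X (p e) b) h" "h 0 = \<alpha>" "h 1 = \<beta>"
    using hom unfolding path_component_of_def pathin_def by blast
  have hb: "h s \<in> topspace (paths_between X (p e) b)" if "s \<in> {0..1}" for s
    using continuous_map_image_subset_topspace[OF h(1)] that by auto
  have "continuous_map unit_interval (path_space X (p e)) h"
    using h(1) hb unfolding continuous_map_into_path_space
    by (auto simp: paths_between_def topspace_paths_between dest: continuous_map_into_fulltopology)
  from continuous_map_compose[OF continuous_map_compose[OF this continuous_map_path_lift[OF cov e]] continuous_map_ev1]
  have "pathin E (\<lambda>s. path_lift E p e (h s) 1)"
    by (simp add: pathin_def o_def)
  moreover have "p (path_lift E p e (h s) 1) = b" if "s \<in> {0..1}" for s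
    using path_lift_ends(2)[OF cov e paths_between_subset_path_space[OF hb[OF that]]] hb[OF that]
    by (simp add: topspace_paths_between)
  ultimately show ?thesis
    using path_in_fibre_constant[OF cov, of "\<lambda>s. path_lift E p e (h s) 1" b 1] h by simp
qed

section \<open>The subgroup of a path covering\<close>

lemma fundamental_group_map_loop_class:
  assumes p: "continuous_map E X p" and \<gamma>: "\<gamma> \<in> topspace (loop_space E e)"
  shows "fundamental_group_map X (p e) p (loop_class E e \<gamma>) = loop_class X (p e) (compose {0..1} p \<gamma>)"
proof -
  have *: "loop_class X (p e) (compose {0..1} p \<gamma>') = loop_class X (p e) (compose {0..1} p \<gamma>)"
    if "\<gamma>' \<in> loop_class E e \<gamma>" for \<gamma>'
  proof -
    have "path_component_of (loop_space X (p e)) (compose {0..1} p \<gamma>) (compose {0..1} p \<gamma>')"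
      using that homotopic_compose[OF _ p] by (simp add: loop_class_eq loop_space_eq)
    then show ?thesis
      using loop_class_eq_iff path_component_in_topspace by metis
  qed
  have "fundamental_group_map X (p e) p (loop_class E e \<gamma>) =
      (\<Union>\<gamma>'\<in>loop_class E e \<gamma>. loop_class X (p e) (compose {0..1} p \<gamma>))"
    unfolding fundamental_group_map_def by (intro SUP_cong refl *)
  moreover have "\<gamma> \<in> loop_class E e \<gamma>"
    using \<gamma> by (simp add: loop_class_eq path_component_of_refl)
  ultimately show ?thesis by auto
qed

lemma image_fundamental_group_map:
  assumes "continuous_map E X p"
  shows "fundamental_group_map X (p e) p ` carrier (fundamental_group E e) =
    (\<lambda>\<gamma>. loop_class X (p e) (compose {0..1} p \<gamma>)) ` topspace (loop_space E e)"
  unfolding carrier_fundamental_group image_image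
  using fundamental_group_map_loop_class[OF assms] by (intro image_cong) auto

lemma compose_loop:
  assumes "continuous_map E X p" and "\<gamma> \<in> topspace (loop_space E e)"
  shows "compose {0..1} p \<gamma> \<in> topspace (loop_space X (p e))"
  using homotopic_compose[OF _ assms(1), of e e \<gamma> \<gamma>] assms(2)
  by (simp add: path_component_of_refl loop_space_eq path_component_in_topspace)

lemma subgroup_image_fundamental_group_map:
  assumes p: "continuous_map E X p" and e: "e \<in> topspace E"
  shows "subgroup (fundamental_group_map X (p e) p ` carrier (fundamental_group E e)) (fundamental_group X (p e))"
proof -
  let ?f = "\<lambda>\<gamma>. loop_class X (p e) (compose {0..1} p \<gamma>)"
  have "p e \<in> topspace X"
    using continuous_map_image_subset_topspace[OF p] e by blast
  then interpret group "fundamental_group X (p e)"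
    by (rule group_fundamental_group)
  show ?thesis
    unfolding image_fundamental_group_map[OF p]
  proof (rule subgroupI)
    show "?f ` topspace (loop_space E e) \<subseteq> carrier (fundamental_group X (p e))"
      using compose_loop[OF p] by (auto simp: carrier_fundamental_group)
    show "?f ` topspace (loop_space E e) \<noteq> {}"
      using const_loop[OF e] by blast
    fix A assume "A \<in> ?f ` topspace (loop_space E e)"
    then obtain \<alpha> where \<alpha>: "\<alpha> \<in> topspace (loop_space E e)" and A: "A = ?f \<alpha>" by blast
    have "inv\<^bsub>fundamental_group X (p e)\<^esub> A = ?f (rev_path \<alpha>)"
      unfolding A compose_rev_path by (rule inv_fundamental_group[OF compose_loop[OF p \<alpha>]])
    then show "inv\<^bsub>fundamental_group X (p e)\<^esub> A \<in> ?f ` topspace (loop_space E e)"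
      using rev_loop[OF \<alpha>] by blast
    fix B assume "B \<in> ?f ` topspace (loop_space E e)"
    then obtain \<beta> where \<beta>: "\<beta> \<in> topspace (loop_space E e)" and B: "B = ?f \<beta>" by blast
    have "A \<otimes>\<^bsub>fundamental_group X (p e)\<^esub> B = ?f (concat_loops \<alpha> \<beta>)"
      unfolding A B compose_concat_loops
      by (rule mult_fundamental_group[OF compose_loop[OF p \<alpha>] compose_loop[OF p \<beta>]])
    then show "A \<otimes>\<^bsub>fundamental_group X (p e)\<^esub> B \<in> ?f ` topspace (loop_space E e)"
      using concat_loop[OF \<alpha> \<beta>] by blast
  qed
qed

text \<open>If the difference loop is homotopic to the projection of a loop \<gamma>, then \<alpha>
  is homotopic to that projection followed by \<beta>, whose lift is \<gamma> followed by the lift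
  of \<beta>. Conversely, two lifts that meet form a loop in \<open>E\<close> that projects to the
  difference loop.\<close>

lemma mem_subgroup_iff_lifts_meet:
  assumes cov: "has_continuous_path_covering E X p" and e: "e \<in> topspace E"
    and \<alpha>: "\<alpha> \<in> topspace (paths_between X (p e) b)" and \<beta>: "\<beta> \<in> topspace (paths_between X (p e) b)"
  shows "loop_class X (p e) (concat_loops \<alpha> (rev_path \<beta>)) \<in>
      fundamental_group_map X (p e) p ` carrier (fundamental_group E e) \<longleftrightarrow>
    path_lift E p e \<alpha> 1 = path_lift E p e \<beta> 1"
proof -
  note p = covering_continuous[OF cov e]
  let ?L = "path_lift E p e"
  note \<alpha>' = paths_between_subset_path_space[OF \<alpha>] and \<beta>' = paths_between_subset_path_space[OF \<beta>]
  have L: "?L \<alpha> \<in> topspace (paths_between E e (?L \<alpha> 1))" "?L \<beta> \<in> topspace (paths_between E e (?L \<beta> 1))"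
    using path_lift_in[OF cov e \<alpha>'] path_lift_in[OF cov e \<beta>'] by (simp_all add: path_space_paths_between)
  have loop: "concat_loops \<alpha> (rev_path \<beta>) \<in> topspace (loop_space X (p e))"
    unfolding loop_space_eq by (rule concat_in_paths_between[OF \<alpha> rev_in_paths_between[OF \<beta>]])
  show ?thesis
  proof
    assume "loop_class X (p e) (concat_loops \<alpha> (rev_path \<beta>)) \<in>
      fundamental_group_map X (p e) p ` carrier (fundamental_group E e)"
    then obtain \<gamma> where \<gamma>: "\<gamma> \<in> topspace (loop_space E e)"
      and "loop_class X (p e) (concat_loops \<alpha> (rev_path \<beta>)) = loop_class X (p e) (compose {0..1} p \<gamma>)"
      unfolding image_fundamental_group_map[OF p] by blast
    then have hom: "path_component_of (paths_between X (p e) (p e)) (concat_loops \<alpha> (rev_path \<beta>)) (compose {0..1} p \<gamma>)"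
      using loop loop_class_eq_iff loop_space_eq by metis
    have "path_component_of (paths_between X (p e) b) \<alpha> (concat_loops (compose {0..1} p \<gamma>) \<beta>)"
      using path_component_of_trans[OF path_component_of_sym[OF homotopic_cancel_right[OF \<alpha> \<beta>]] homotopic_concat_right[OF hom \<beta>]] .
    then have "?L \<alpha> 1 = ?L (concat_loops (compose {0..1} p \<gamma>) \<beta>) 1"
      by (rule path_lift_homotopic[OF cov e])
    moreover have "concat_loops \<gamma> (?L \<beta>) \<in> topspace (path_space E e)"
      using concat_in_paths_between[OF \<gamma>[unfolded loop_space_eq] L(2)] by (rule paths_between_subset_path_space)
    then have "?L (compose {0..1} p (concat_loops \<gamma> (?L \<beta>))) = concat_loops \<gamma> (?L \<beta>)"
      by (rule path_lift_compose[OF cov e])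
    then have "?L (concat_loops (compose {0..1} p \<gamma>) \<beta>) = concat_loops \<gamma> (?L \<beta>)"
      by (simp add: compose_concat_loops compose_path_lift[OF cov e \<beta>'])
    ultimately show "?L \<alpha> 1 = ?L \<beta> 1"
      by (simp add: concat_loops_1)
  next
    assume eq: "?L \<alpha> 1 = ?L \<beta> 1"
    have "concat_loops (?L \<alpha>) (rev_path (?L \<beta>)) \<in> topspace (loop_space E e)"
      unfolding loop_space_eq using concat_in_paths_between[OF L(1)] rev_in_paths_between[OF L(2)] eq by simp
    moreover have "compose {0..1} p (concat_loops (?L \<alpha>) (rev_path (?L \<beta>))) = concat_loops \<alpha> (rev_path \<beta>)"
      by (simp add: compose_concat_loops compose_rev_path compose_path_lift[OF cov e] \<alpha>' \<beta>')
    ultimately show "loop_class X (p e) (concat_loops \<alpha> (rev_path \<beta>)) \<in>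
      fundamental_group_map X (p e) p ` carrier (fundamental_group E e)"
      unfolding image_fundamental_group_map[OF p] by force
  qed
qed

lemma quotient_map_coset_space:
  "quotient_map (loop_space X x) (coset_space X x H) (\<lambda>\<alpha>. H #>\<^bsub>fundamental_group X x\<^esub> loop_class X x \<alpha>)"
  using quotient_map_compose[OF quotient_map_quotient_topology quotient_map_quotient_topology]
  unfolding coset_space_def fundamental_group_topology_def o_def by blast

text \<open>Sending the coset of a loop to the end point of its lift is well defined and injective
  by \<open>mem_subgroup_iff_lifts_meet\<close>, and continuous because the coset space is a
  quotient of the loop space. Its values lie in the fibre over \<open>p e\<close>, where paths are
  constant.\<close>

lemma coset_space_totally_path_disconnected:
  assumes cov: "has_continuous_path_covering E X p" and e: "e \<in> topspace E"
  shows "totally_path_disconnected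
    (coset_space X (p e) (fundamental_group_map X (p e) p ` carrier (fundamental_group E e)))"
proof -
  define H where "H = fundamental_group_map X (p e) p ` carrier (fundamental_group E e)"
  define c where "c = (\<lambda>\<alpha>. H #>\<^bsub>fundamental_group X (p e)\<^esub> loop_class X (p e) \<alpha>)"
  let ?L = "path_lift E p e"
  have H: "subgroup H (fundamental_group X (p e))"
    unfolding H_def by (rule subgroup_image_fundamental_group_map[OF covering_continuous[OF cov e] e])
  have q: "quotient_map (loop_space X (p e)) (coset_space X (p e) H) c"
    unfolding c_def by (rule quotient_map_coset_space)
  have c_eq: "c \<alpha> = c \<beta> \<longleftrightarrow> ?L \<alpha> 1 = ?L \<beta> 1"
    if "\<alpha> \<in> topspace (loop_space X (p e))" "\<beta> \<in> topspace (loop_space X (p e))" for \<alpha> \<beta>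
    unfolding c_def coset_eq_iff[OF H that] unfolding H_def
    using that by (intro mem_subgroup_iff_lifts_meet[OF cov e]) (simp_all add: loop_space_eq)
  have "continuous_map (loop_space X (p e)) (path_space X (p e)) (\<lambda>\<alpha>. \<alpha>)"
    unfolding continuous_map_into_path_space loop_space_eq
    by (auto simp: continuous_map_paths_between_free topspace_paths_between)
  from continuous_map_compose[OF continuous_map_compose[OF this continuous_map_path_lift[OF cov e]] continuous_map_ev1]
  have "continuous_map (loop_space X (p e)) E (\<lambda>\<alpha>. ?L \<alpha> 1)"
    by (simp add: o_def)
  then obtain k where k: "continuous_map (coset_space X (p e) H) E k"
    and kc: "\<And>\<alpha>. \<alpha> \<in> topspace (loop_space X (p e)) \<Longrightarrow> k (c \<alpha>) = ?L \<alpha> 1"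
    using quotient_map_lift_exists[OF q, of E "\<lambda>\<alpha>. ?L \<alpha> 1"] c_eq by metis
  have surj: "\<exists>\<alpha>\<in>topspace (loop_space X (p e)). C = c \<alpha>" if "C \<in> topspace (coset_space X (p e) H)" for C
    using quotient_imp_surjective_map[OF q] that by blast
  have inj: "inj_on k (topspace (coset_space X (p e) H))"
    by (rule inj_onI) (metis surj kc c_eq)
  have fib: "p (k C) = p e" if C: "C \<in> topspace (coset_space X (p e) H)" for C
  proof -
    obtain \<alpha> where \<alpha>: "\<alpha> \<in> topspace (loop_space X (p e))" "C = c \<alpha>"
      using surj[OF C] by blast
    then show ?thesis
      using path_lift_ends(2)[OF cov e, of \<alpha>] kc by (simp add: topspace_loop_space topspace_path_space)
  qed
  have "g s = g t" if g: "pathin (coset_space X (p e) H) g" and s: "s \<in> {0..1}" and t: "t \<in> {0..1}" for g s t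
  proof -
    have kg: "pathin E (k \<circ> g)"
      using g k by (simp add: pathin_compose)
    have "(k \<circ> g) s = (k \<circ> g) 0" "(k \<circ> g) t = (k \<circ> g) 0"
      by (rule path_in_fibre_constant[OF cov kg, where x = "p e"];
        use s t pathin_in_topspace[OF g] fib in simp)+
    then show ?thesis
      using inj_onD[OF inj _ pathin_in_topspace[OF g s] pathin_in_topspace[OF g t]] by simp
  qed
  then show ?thesis
    unfolding totally_path_disconnected_def H_def by blast
qed

section \<open>Bijections of path coverings are weak homotopy equivalences\<close>

text \<open>A contraction of \<open>A\<close> turns \<open>g\<close> into a continuous family of
  paths \<open>G a\<close> in \<open>E\<close>. Their projections lift continuously to
  \<open>E'\<close>; by unique lifting in \<open>E\<close>, the map \<open>f\<close> sends these
  lifts back to the paths \<open>G a\<close>, so they end at the preimages of the values of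
  \<open>g\<close>.\<close>

lemma continuous_map_inverse_on_contractible:
  assumes cov: "has_continuous_path_covering E X p" and cov': "has_continuous_path_covering E' X p'"
    and f: "continuous_map E' E f" and bij: "bij_betw f (topspace E') (topspace E)"
    and pf: "\<And>y. y \<in> topspace E' \<Longrightarrow> p (f y) = p' y"
    and A: "contractible_space A" and g: "continuous_map A E g"
  shows "continuous_map A E' (\<lambda>a. inv_into (topspace E') f (g a))"
proof (cases "topspace A = {}")
  case True
  then show ?thesis
    by (metis null_topspace_iff_trivial continuous_map_on_empty)
next
  case False
  then obtain a0 where a0: "a0 \<in> topspace A" by blast
  \<comment> \<open>Oriented from the constant map to the identity, so that the track of each
    \<open>a\<close> starts at \<open>a0\<close> and ends at \<open>a\<close>.\<close>
  then have "homotopic_with (\<lambda>x. True) A A (\<lambda>x. a0) id"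
    using A homotopic_with_symD by (metis contractible_space_alt)
  then obtain c where c: "continuous_map (prod_topology unit_interval A) A c"
    and c0: "\<And>a. c (0, a) = a0" and c1: "\<And>a. c (1, a) = a"
    unfolding homotopic_with_def by auto
  have gA: "g a \<in> topspace E" if "a \<in> topspace A" for a
    using continuous_map_image_subset_topspace[OF g] that by blast
  define e where "e = inv_into (topspace E') f (g a0)"
  have e: "e \<in> topspace E'" and fe: "f e = g a0"
    unfolding e_def using gA[OF a0] bij by (auto simp: bij_betw_def inv_into_into f_inv_into_f)
  have fe': "f e \<in> topspace E" using fe gA[OF a0] by simp
  define G where "G = (\<lambda>a. restrict (\<lambda>t. g (c (t, a))) {0..1})"
  have "continuous_map (prod_topology unit_interval A) E (\<lambda>w. g (c (fst w, snd w)))"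
    using continuous_map_compose[OF c g] by (simp add: o_def)
  then have G: "continuous_map A (path_space E (f e)) G"
    unfolding continuous_map_into_path_space G_def
    by (auto intro: continuous_map_into_free_paths simp: c0 fe)
  define K where "K = (\<lambda>a. path_lift E' p' e (compose {0..1} p (G a)))"
  have pe: "p' e = p (f e)" using pf[OF e] by simp
  have "continuous_map (path_space E (f e)) (path_space X (p (f e))) (compose {0..1} p)"
    using homeomorphic_map_path_lift[OF cov fe'] by (simp add: homeomorphic_maps_def)
  from continuous_map_compose[OF continuous_map_compose[OF G this]
      continuous_map_path_lift[OF cov' e, unfolded pe]]
  have K: "continuous_map A (path_space E' e) K"
    by (simp add: K_def o_def)
  have "inv_into (topspace E') f (g a) = K a 1" if a: "a \<in> topspace A" for a
  proof -
    have Ka: "K a \<in> topspace (path_space E' e)" and Ga: "G a \<in> topspace (path_space E (f e))"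
      using continuous_map_image_subset_topspace[OF K] continuous_map_image_subset_topspace[OF G] a by blast+
    have K1: "K a t \<in> topspace E'" if "t \<in> {0..1}" for t
      using Ka that by (auto simp: topspace_path_space intro: pathin_in_topspace)
    have "compose {0..1} f (K a) \<in> topspace (path_space E (f e))"
      using Ka f by (auto simp: topspace_path_space compose_def pathin_restrict pathin_compose[unfolded o_def])
    moreover have "compose {0..1} p (compose {0..1} f (K a)) = compose {0..1} p' (K a)"
      using K1 pf by (auto simp: compose_def fun_eq_iff)
    moreover have "compose {0..1} p' (K a) = compose {0..1} p (G a)"
      unfolding K_def using compose_in_path_space[OF cov fe' Ga] pe
      by (intro compose_path_lift[OF cov' e]) simp
    \<comment> \<open>Both paths start at \<open>f e\<close> and have the same projection to
      \<open>X\<close>.\<close>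
    ultimately have "compose {0..1} f (K a) = G a"
      using path_lift_compose[OF cov fe'] Ga by metis
    then have "compose {0..1} f (K a) 1 = G a 1" by simp
    then have "f (K a 1) = g a"
      by (simp add: compose_def G_def c1)
    then show ?thesis
      using inv_into_f_f[of f "topspace E'" "K a 1"] bij K1[of 1] by (simp add: bij_betw_def)
  qed
  moreover have "continuous_map A E' (\<lambda>a. K a 1)"
    using continuous_map_compose[OF K continuous_map_ev1] by (simp add: o_def)
  ultimately show ?thesis
    by (auto elim: continuous_map_eq)
qed

section \<open>Homotopy classes of spheroids under continuous bijections\<close>

lemma contractible_space_cube: "contractible_space (cube n)"
  unfolding cube_def
  by (simp add: contractible_space_product_topology convex_imp_contractible)

lemma cube_boundary_subset: "x \<in> cube_boundary n \<Longrightarrow> x \<in> topspace (cube n)"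
  by (simp add: cube_boundary_def)

text \<open>The homotopy in \<open>homotopic_with\<close> has to match its two ends at every
  argument, also off the cube. The boundary condition looks only at points of the cube, so agreement
  there is enough.\<close>

lemma spheroid_homotopy_iff:
  "(\<alpha>, \<beta>) \<in> spheroid_homotopy n Y y \<longleftrightarrow>
    (\<exists>h. continuous_map (prod_topology unit_interval (cube n)) Y h \<and>
       (\<forall>x\<in>topspace (cube n). h (0, x) = \<alpha> x) \<and> (\<forall>x\<in>topspace (cube n). h (1, x) = \<beta> x) \<and>
       (\<forall>t\<in>{0..1}. \<forall>x\<in>cube_boundary n. h (t, x) = y))"
  unfolding spheroid_homotopy_def mem_Collect_eq case_prod_conv
  by (rule homotopic_with) (metis cube_boundary_subset)

lemma equiv_spheroid_homotopy: "equiv (spheroids n Y y) (spheroid_homotopy n Y y)"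
proof (rule equivI)
  show "spheroid_homotopy n Y y \<subseteq> spheroids n Y y \<times> spheroids n Y y"
    by (auto simp: spheroid_homotopy_def spheroids_def
      dest: homotopic_with_imp_continuous_maps homotopic_with_imp_property)
  show "refl_on (spheroids n Y y) (spheroid_homotopy n Y y)"
    by (auto simp: refl_on_def spheroid_homotopy_def spheroids_def)
  show "sym (spheroid_homotopy n Y y)"
    by (auto simp: sym_def spheroid_homotopy_def intro: homotopic_with_symD)
  show "trans (spheroid_homotopy n Y y)"
    by (auto simp: trans_def spheroid_homotopy_def intro: homotopic_with_trans)
qed

text \<open>The inverse of \<open>f\<close> is required to be continuous only after maps from the
  cube and from the cylinder over it: the former lets spheroids be pulled back, which gives
  surjectivity on classes, the latter homotopies, which gives injectivity.\<close>

lemma bij_betw_homotopy_classes_map: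
  assumes f: "continuous_map Y Z f" and bij: "bij_betw f (topspace Y) (topspace Z)"
    and inv: "\<And>g. continuous_map (cube n) Z g \<Longrightarrow> continuous_map (cube n) Y (\<lambda>x. inv_into (topspace Y) f (g x))"
    and inv_homotopy: "\<And>g. continuous_map (prod_topology unit_interval (cube n)) Z g \<Longrightarrow>
      continuous_map (prod_topology unit_interval (cube n)) Y (\<lambda>w. inv_into (topspace Y) f (g w))"
    and y: "y \<in> topspace Y"
  shows "bij_betw (homotopy_classes_map n Z (f y) f) (homotopy_classes n Y y) (homotopy_classes n Z (f y))"
proof -
  let ?R = "spheroid_homotopy n Y y" and ?S = "spheroid_homotopy n Z (f y)"
  let ?k = "inv_into (topspace Y) f"
  have kf: "?k (f v) = v" if "v \<in> topspace Y" for v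
    using bij that by (simp add: bij_betw_def)
  have fk: "f (?k v) = v" if "v \<in> topspace Z" for v
    using bij that by (auto simp: bij_betw_def f_inv_into_f)
  have sph: "f \<circ> \<alpha> \<in> spheroids n Z (f y)" if "\<alpha> \<in> spheroids n Y y" for \<alpha>
    using that f by (auto simp: spheroids_def intro: continuous_map_compose)
  have fR: "(f \<circ> \<alpha>, f \<circ> \<beta>) \<in> ?S" if "(\<alpha>, \<beta>) \<in> ?R" for \<alpha> \<beta>
    using that unfolding spheroid_homotopy_def
    by (auto intro: homotopic_with_compose_continuous_map_left[OF _ f])
  have map: "homotopy_classes_map n Z (f y) f (?R `` {\<alpha>}) = ?S `` {f \<circ> \<alpha>}" if \<alpha>: "\<alpha> \<in> spheroids n Y y" for \<alpha>
  proof -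
    have "?S `` {f \<circ> \<alpha>'} = ?S `` {f \<circ> \<alpha>}" if "\<alpha>' \<in> ?R `` {\<alpha>}" for \<alpha>'
      using equiv_class_eq[OF equiv_spheroid_homotopy fR] that by blast
    then have "homotopy_classes_map n Z (f y) f (?R `` {\<alpha>}) = (\<Union>\<alpha>'\<in>?R `` {\<alpha>}. ?S `` {f \<circ> \<alpha>})"
      unfolding homotopy_classes_map_def by (intro SUP_cong refl)
    moreover have "\<alpha> \<in> ?R `` {\<alpha>}"
      by (rule equiv_class_self[OF equiv_spheroid_homotopy \<alpha>])
    ultimately show ?thesis by auto
  qed
  have inj: "(\<alpha>, \<beta>) \<in> ?R" if \<alpha>: "\<alpha> \<in> spheroids n Y y" and \<beta>: "\<beta> \<in> spheroids n Y y"
    and "(f \<circ> \<alpha>, f \<circ> \<beta>) \<in> ?S" for \<alpha> \<beta>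
  proof -
    obtain h where h: "continuous_map (prod_topology unit_interval (cube n)) Z h"
      and h01: "\<And>x. x \<in> topspace (cube n) \<Longrightarrow> h (0, x) = f (\<alpha> x)"
        "\<And>x. x \<in> topspace (cube n) \<Longrightarrow> h (1, x) = f (\<beta> x)"
      and hb: "\<And>t x. t \<in> {0..1} \<Longrightarrow> x \<in> cube_boundary n \<Longrightarrow> h (t, x) = f y"
      using \<open>(f \<circ> \<alpha>, f \<circ> \<beta>) \<in> ?S\<close> unfolding spheroid_homotopy_iff by auto
    have "\<alpha> x \<in> topspace Y" "\<beta> x \<in> topspace Y" if "x \<in> topspace (cube n)" for x
      using \<alpha> \<beta> that by (auto simp: spheroids_def dest: continuous_map_image_subset_topspace)
    then show ?thesis
      unfolding spheroid_homotopy_iff using inv_homotopy[OF h] y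
      by (intro exI[of _ "\<lambda>w. ?k (h w)"]) (simp add: h01 hb kf)
  qed
  have surj: "\<exists>\<beta>\<in>spheroids n Y y. (f \<circ> \<beta>, \<alpha>) \<in> ?S" if \<alpha>: "\<alpha> \<in> spheroids n Z (f y)" for \<alpha>
  proof
    have c: "continuous_map (cube n) Z \<alpha>" and b: "\<And>x. x \<in> cube_boundary n \<Longrightarrow> \<alpha> x = f y"
      using \<alpha> by (auto simp: spheroids_def)
    show \<beta>: "(\<lambda>x. ?k (\<alpha> x)) \<in> spheroids n Y y"
      using inv[OF c] b y by (simp add: spheroids_def kf)
    \<comment> \<open>The pulled-back spheroid composed with \<open>f\<close> agrees with \<alpha>
      on the cube but possibly not outside it, so the two are shown to be homotopic rather than
      equal.\<close>
    have "f (?k (\<alpha> x)) = \<alpha> x" if "x \<in> topspace (cube n)" for x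
      using continuous_map_image_subset_topspace[OF c] that by (intro fk) blast
    then show "(f \<circ> (\<lambda>x. ?k (\<alpha> x)), \<alpha>) \<in> ?S"
      using sph[OF \<beta>] b unfolding spheroid_homotopy_def
      by (auto simp: spheroids_def o_def intro!: homotopic_with_equal)
  qed
  show ?thesis
    unfolding bij_betw_def
  proof
    show "inj_on (homotopy_classes_map n Z (f y) f) (homotopy_classes n Y y)"
    proof (rule inj_onI)
      fix A B assume "A \<in> homotopy_classes n Y y" "B \<in> homotopy_classes n Y y"
        and eq: "homotopy_classes_map n Z (f y) f A = homotopy_classes_map n Z (f y) f B"
      then obtain \<alpha> \<beta> where A: "A = ?R `` {\<alpha>}" and \<alpha>: "\<alpha> \<in> spheroids n Y y"
        and B: "B = ?R `` {\<beta>}" and \<beta>: "\<beta> \<in> spheroids n Y y"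
        unfolding homotopy_classes_def quotient_def by blast
      have "(f \<circ> \<alpha>, f \<circ> \<beta>) \<in> ?S"
        using eq eq_equiv_class[OF _ equiv_spheroid_homotopy sph[OF \<beta>]] by (simp add: A B map \<alpha> \<beta>)
      then show "A = B"
        unfolding A B using equiv_class_eq[OF equiv_spheroid_homotopy inj[OF \<alpha> \<beta>]] by blast
    qed
    show "homotopy_classes_map n Z (f y) f ` homotopy_classes n Y y = homotopy_classes n Z (f y)"
    proof
      show "homotopy_classes_map n Z (f y) f ` homotopy_classes n Y y \<subseteq> homotopy_classes n Z (f y)"
        unfolding homotopy_classes_def by (auto simp: map elim!: quotientE intro!: quotientI sph)
      show "homotopy_classes n Z (f y) \<subseteq> homotopy_classes_map n Z (f y) f ` homotopy_classes n Y y"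
      proof
        fix A assume "A \<in> homotopy_classes n Z (f y)"
        then obtain \<alpha> where A: "A = ?S `` {\<alpha>}" and \<alpha>: "\<alpha> \<in> spheroids n Z (f y)"
          unfolding homotopy_classes_def quotient_def by blast
        obtain \<beta> where \<beta>: "\<beta> \<in> spheroids n Y y" "(f \<circ> \<beta>, \<alpha>) \<in> ?S"
          using surj[OF \<alpha>] by blast
        have "A = homotopy_classes_map n Z (f y) f (?R `` {\<beta>})"
          unfolding A map[OF \<beta>(1)] using equiv_class_eq[OF equiv_spheroid_homotopy \<beta>(2)] by simp
        then show "A \<in> homotopy_classes_map n Z (f y) f ` homotopy_classes n Y y"
          using \<beta>(1) unfolding homotopy_classes_def by (blast intro: quotientI)
      qed
    qed
  qed
qed

lemma path_components_map_path_connected: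
  assumes f: "continuous_map Y Z f" and "path_connected_space Y" "topspace Y \<noteq> {}"
    and "path_connected_space Z" "topspace Z \<noteq> {}"
  shows "bij_betw (path_components_map Z f) (path_components_of Y) (path_components_of Z)"
proof -
  have "path_component_of_set Z (f y) = topspace Z" if "y \<in> topspace Y" for y
    using assms(4) continuous_map_image_subset_topspace[OF f] that
    by (auto simp: path_connected_space_path_component_set)
  then have "path_components_map Z f (topspace Y) = topspace Z"
    using assms(3) by (auto simp: path_components_map_def)
  moreover have "path_components_of Y = {topspace Y}" "path_components_of Z = {topspace Z}"
    using assms by (simp_all add: path_components_of_eq_singleton)
  ultimately show ?thesis
    by (simp add: bij_betw_def)
qed

lemma bijection_weak_homotopy_equivalence:
  assumes E: "path_covering_map E X p" and E': "path_covering_map E' X p'"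
    and f: "continuous_map E' E f" and bij: "bij_betw f (topspace E') (topspace E)"
    and pf: "\<And>y. y \<in> topspace E' \<Longrightarrow> p (f y) = p' y"
  shows "weak_homotopy_equivalence E' E f"
proof -
  have cov: "has_continuous_path_covering E X p" "has_continuous_path_covering E' X p'"
    using E E' by (simp_all add: path_covering_map_def)
  have "contractible_space (prod_topology unit_interval (cube n))" for n
    by (simp add: contractible_space_prod_topology contractible_space_cube convex_imp_contractible)
  then show ?thesis
    unfolding weak_homotopy_equivalence_def using E E'
    by (auto simp: path_covering_map_def f bij
      intro!: path_components_map_path_connected bij_betw_homotopy_classes_map contractible_space_cube
        continuous_map_inverse_on_contractible[OF cov f bij pf])
qed

section \<open>The path covering of a subgroup\<close>

text \<open>Classes are kept as sets of paths in \<open>X\<close>, so that the total space has the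
  point type \<open>(real \<Rightarrow> 'a) set\<close> over which total spaces are
  quantified.\<close>

definition path_coset :: "'a topology \<Rightarrow> 'a \<Rightarrow> (real \<Rightarrow> 'a) set set \<Rightarrow> (real \<Rightarrow> 'a) \<Rightarrow> (real \<Rightarrow> 'a) set" where
  "path_coset X x H \<alpha> =
     {\<beta> \<in> topspace (path_space X x). \<beta> 1 = \<alpha> 1 \<and> loop_class X x (concat_loops \<beta> (rev_path \<alpha>)) \<in> H}"

definition path_coset_space :: "'a topology \<Rightarrow> 'a \<Rightarrow> (real \<Rightarrow> 'a) set set \<Rightarrow> (real \<Rightarrow> 'a) set topology" where
  "path_coset_space X x H = quotient_topology (path_space X x) (path_coset X x H)"

text \<open>All paths in a class share their final point, so the chosen representative does not
  matter.\<close>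

definition endpoint :: "(real \<Rightarrow> 'a) set \<Rightarrow> 'a" where
  "endpoint C = (SOME \<alpha>. \<alpha> \<in> C) 1"

lemma quotient_map_path_coset: "quotient_map (path_space X x) (path_coset_space X x H) (path_coset X x H)"
  unfolding path_coset_space_def by (rule quotient_map_quotient_topology)

lemma topspace_path_coset_space: "topspace (path_coset_space X x H) = path_coset X x H ` topspace (path_space X x)"
  by (simp add: path_coset_space_def topspace_quotient_topology)

section \<open>Difference loops of paths with a common end\<close>

lemma difference_loop:
  assumes "\<alpha> \<in> topspace (path_space X x)" and "\<beta> \<in> topspace (path_space X x)" and "\<alpha> 1 = \<beta> 1"
  shows "concat_loops \<alpha> (rev_path \<beta>) \<in> topspace (loop_space X x)"
  using assms concat_in_paths_between[of \<alpha> X x "\<beta> 1" "rev_path \<beta>" x] rev_in_paths_between[of \<beta> X x "\<beta> 1"]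
  by (simp add: path_space_paths_between loop_space_eq)

text \<open>After reassociation the middle part, \<beta> reversed followed by \<beta>, cancels. This
  cocycle rule yields both the transitivity of the relation that defines the classes and the formula
  for inverses.\<close>

lemma difference_loop_mult:
  assumes \<alpha>: "\<alpha> \<in> topspace (path_space X x)" and \<beta>: "\<beta> \<in> topspace (path_space X x)"
    and \<gamma>: "\<gamma> \<in> topspace (path_space X x)" and eq: "\<alpha> 1 = \<beta> 1" "\<beta> 1 = \<gamma> 1"
  shows "loop_class X x (concat_loops \<alpha> (rev_path \<beta>)) \<otimes>\<^bsub>fundamental_group X x\<^esub>
      loop_class X x (concat_loops \<beta> (rev_path \<gamma>)) = loop_class X x (concat_loops \<alpha> (rev_path \<gamma>))"
proof -
  define b where "b = \<gamma> 1"
  have ab: "\<alpha> \<in> topspace (paths_between X x b)" and bb: "\<beta> \<in> topspace (paths_between X x b)"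
    and gb: "\<gamma> \<in> topspace (paths_between X x b)"
    using assms by (simp_all add: path_space_paths_between b_def)
  note \<beta>\<gamma> = concat_in_paths_between[OF bb rev_in_paths_between[OF gb]]
  have "path_component_of (paths_between X b x)
      (concat_loops (rev_path \<beta>) (concat_loops \<beta> (rev_path \<gamma>))) (rev_path \<gamma>)"
    using homotopic_cancel_left[OF rev_in_paths_between[OF bb] rev_in_paths_between[OF gb]]
      rev_path_rev_path[OF extensional_if_between[OF bb]] by simp
  from path_component_of_trans[OF homotopic_assoc[OF ab rev_in_paths_between[OF bb] \<beta>\<gamma>]
      homotopic_concat_left[OF ab this]]
  have "path_component_of (loop_space X x)
     (concat_loops (concat_loops \<alpha> (rev_path \<beta>)) (concat_loops \<beta> (rev_path \<gamma>))) (concat_loops \<alpha> (rev_path \<gamma>))"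
    by (simp add: loop_space_eq)
  then show ?thesis
    using difference_loop[OF \<alpha> \<beta> eq(1)] difference_loop[OF \<beta> \<gamma> eq(2)]
    by (simp add: mult_fundamental_group loop_class_eq_iff concat_loop)
qed

lemma difference_loop_self:
  assumes "\<alpha> \<in> topspace (path_space X x)"
  shows "loop_class X x (concat_loops \<alpha> (rev_path \<alpha>)) = \<one>\<^bsub>fundamental_group X x\<^esub>"
  using homotopic_right_inverse[of \<alpha> X x "\<alpha> 1"] assms difference_loop[OF assms assms refl]
  by (simp add: path_space_paths_between one_fundamental_group loop_class_eq_iff loop_space_eq)

lemma base_in_topspace: "\<alpha> \<in> topspace (path_space X x) \<Longrightarrow> x \<in> topspace X"
  by (auto simp: topspace_path_space dest: pathin_in_topspace[of _ _ 0])

lemma const_in_path_space: "x \<in> topspace X \<Longrightarrow> restrict (\<lambda>_. x) {0..1} \<in> topspace (path_space X x)"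
  using const_in_paths_between paths_between_subset_path_space by metis

lemma difference_loop_inv:
  assumes \<alpha>: "\<alpha> \<in> topspace (path_space X x)" and \<beta>: "\<beta> \<in> topspace (path_space X x)" and eq: "\<alpha> 1 = \<beta> 1"
  shows "inv\<^bsub>fundamental_group X x\<^esub> loop_class X x (concat_loops \<alpha> (rev_path \<beta>)) =
    loop_class X x (concat_loops \<beta> (rev_path \<alpha>))"
  using difference_loop_mult[OF \<beta> \<alpha> \<beta>] difference_loop_self[OF \<beta>] difference_loop[OF \<alpha> \<beta> eq]
    difference_loop[OF \<beta> \<alpha>] eq
  by (intro group.inv_equality[OF group_fundamental_group[OF base_in_topspace[OF \<alpha>]]])
    (auto simp: carrier_fundamental_group)

context
  fixes X :: "'a topology" and x :: 'a and H :: "(real \<Rightarrow> 'a) set set"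
  assumes H: "subgroup H (fundamental_group X x)"
begin

text \<open>The subgroup laws of \<open>H\<close> make the relation an equivalence: the unit gives
  reflexivity, products give transitivity and inverses give symmetry.\<close>

lemma path_coset_eq_iff:
  assumes \<alpha>: "\<alpha> \<in> topspace (path_space X x)" and \<beta>: "\<beta> \<in> topspace (path_space X x)"
  shows "path_coset X x H \<alpha> = path_coset X x H \<beta> \<longleftrightarrow>
    \<alpha> 1 = \<beta> 1 \<and> loop_class X x (concat_loops \<alpha> (rev_path \<beta>)) \<in> H"
proof
  assume "path_coset X x H \<alpha> = path_coset X x H \<beta>"
  moreover have "\<alpha> \<in> path_coset X x H \<alpha>"
    using \<alpha> subgroup.one_closed[OF H] by (simp add: path_coset_def difference_loop_self)
  ultimately show "\<alpha> 1 = \<beta> 1 \<and> loop_class X x (concat_loops \<alpha> (rev_path \<beta>)) \<in> H"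
    by (simp add: path_coset_def)
next
  have sub: "path_coset X x H \<alpha> \<subseteq> path_coset X x H \<beta>"
    if "\<alpha> \<in> topspace (path_space X x)" "\<beta> \<in> topspace (path_space X x)"
      "\<alpha> 1 = \<beta> 1" "loop_class X x (concat_loops \<alpha> (rev_path \<beta>)) \<in> H" for \<alpha> \<beta>
  proof
    fix \<gamma> assume \<gamma>: "\<gamma> \<in> path_coset X x H \<alpha>"
    then have "loop_class X x (concat_loops \<gamma> (rev_path \<alpha>)) \<otimes>\<^bsub>fundamental_group X x\<^esub>
        loop_class X x (concat_loops \<alpha> (rev_path \<beta>)) \<in> H"
      using that by (intro subgroup.m_closed[OF H]) (simp_all add: path_coset_def)
    then show "\<gamma> \<in> path_coset X x H \<beta>"
      using difference_loop_mult[of \<gamma> X x \<alpha> \<beta>] \<gamma> that by (simp add: path_coset_def)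
  qed
  assume eq: "\<alpha> 1 = \<beta> 1 \<and> loop_class X x (concat_loops \<alpha> (rev_path \<beta>)) \<in> H"
  then have "loop_class X x (concat_loops \<beta> (rev_path \<alpha>)) \<in> H"
    using subgroup.m_inv_closed[OF H] difference_loop_inv[OF \<alpha> \<beta>] by metis
  then show "path_coset X x H \<alpha> = path_coset X x H \<beta>"
    using sub[OF \<alpha> \<beta>] sub[OF \<beta> \<alpha>] eq by auto
qed

lemma path_coset_homotopic:
  assumes "path_component_of (paths_between X x b) \<alpha> \<beta>"
  shows "path_coset X x H \<alpha> = path_coset X x H \<beta>"
proof -
  have \<alpha>: "\<alpha> \<in> topspace (paths_between X x b)" and \<beta>: "\<beta> \<in> topspace (paths_between X x b)"
    using path_component_in_topspace[OF assms] by auto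
  note \<alpha>' = paths_between_subset_path_space[OF \<alpha>] and \<beta>' = paths_between_subset_path_space[OF \<beta>]
  have eq: "\<alpha> 1 = \<beta> 1"
    using \<alpha> \<beta> by (simp add: topspace_paths_between)
  have "path_component_of (loop_space X x) (concat_loops \<alpha> (rev_path \<beta>)) (concat_loops \<beta> (rev_path \<beta>))"
    unfolding loop_space_eq by (rule homotopic_concat_right[OF assms rev_in_paths_between[OF \<beta>]])
  then have "loop_class X x (concat_loops \<alpha> (rev_path \<beta>)) = \<one>\<^bsub>fundamental_group X x\<^esub>"
    using loop_class_eq_iff[OF difference_loop[OF \<alpha>' \<beta>' eq]] difference_loop_self[OF \<beta>'] by metis
  then show ?thesis
    using subgroup.one_closed[OF H] eq by (simp add: path_coset_eq_iff[OF \<alpha>' \<beta>'])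
qed



lemma endpoint_path_coset:
  assumes "\<alpha> \<in> topspace (path_space X x)"
  shows "endpoint (path_coset X x H \<alpha>) = \<alpha> 1"
proof -
  have "\<alpha> \<in> path_coset X x H \<alpha>"
    using assms subgroup.one_closed[OF H] by (simp add: path_coset_def difference_loop_self)
  then have "(SOME \<beta>. \<beta> \<in> path_coset X x H \<alpha>) \<in> path_coset X x H \<alpha>"
    by (rule someI[of "\<lambda>\<beta>. \<beta> \<in> path_coset X x H \<alpha>"])
  then show ?thesis
    by (simp add: endpoint_def path_coset_def)
qed

lemma continuous_map_endpoint: "continuous_map (path_coset_space X x H) X endpoint"
proof (rule continuous_compose_quotient_map[OF quotient_map_path_coset])
  show "continuous_map (path_space X x) X (endpoint \<circ> path_coset X x H)"
    by (rule continuous_map_eq[OF continuous_map_ev1]) (simp add: endpoint_path_coset)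
qed

section \<open>Standard lifts to the space of classes\<close>

definition standard_lift :: "(real \<Rightarrow> 'a) \<Rightarrow> (real \<Rightarrow> 'a) \<Rightarrow> real \<Rightarrow> (real \<Rightarrow> 'a) set" where
  "standard_lift \<beta> \<alpha> = restrict (\<lambda>t. path_coset X x H (concat_loops \<beta> (trunc_path t \<alpha>))) {0..1}"

lemma concat_trunc_in_path_space:
  assumes "\<beta> \<in> topspace (path_space X x)" and "\<alpha> \<in> topspace (path_space X (\<beta> 1))" and "t \<in> {0..1}"
  shows "concat_loops \<beta> (trunc_path t \<alpha>) \<in> topspace (path_space X x)"
  using concat_in_paths_between[of \<beta> X x "\<beta> 1" "trunc_path t \<alpha>" "\<alpha> t"] trunc_in_paths_between[of \<alpha> X "\<beta> 1" "\<alpha> 1" t] assms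
  by (simp add: path_space_paths_between path_ends)

lemma continuous_map_concat_trunc:
  assumes \<beta>: "\<beta> \<in> topspace (path_space X x)"
    and f: "continuous_map Z (path_space X (\<beta> 1)) f" and u: "continuous_map Z unit_interval u"
  shows "continuous_map Z (path_space X x) (\<lambda>z. concat_loops \<beta> (trunc_path (u z) (f z)))"
proof -
  have "continuous_map Z (free_paths X) (\<lambda>z. concat_loops \<beta> (trunc_path (u z) (f z)))"
    using f u \<beta> unfolding continuous_map_into_path_space
    by (intro continuous_map_concat_loops continuous_map_trunc_path)
      (auto simp: topspace_path_space topspace_free_paths path_ends)
  then show ?thesis
    using \<beta> by (simp add: continuous_map_into_path_space path_ends topspace_path_space)
qed

text \<open>Extending \<beta> by initial segments of \<alpha> is jointly continuous in the time and
  in \<alpha> already for representatives; passing to classes and currying in the time keeps this.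
  At time 0 the segment is constant, so the lift starts at the class of \<beta>.\<close>

lemma continuous_map_standard_lift:
  assumes \<beta>: "\<beta> \<in> topspace (path_space X x)"
  shows "continuous_map (path_space X (\<beta> 1)) (path_space (path_coset_space X x H) (path_coset X x H \<beta>)) (standard_lift \<beta>)"
proof -
  have "continuous_map (prod_topology unit_interval (path_space X (\<beta> 1))) (path_space X x)
      (\<lambda>w. concat_loops \<beta> (trunc_path (fst w) (snd w)))"
    by (rule continuous_map_concat_trunc[OF \<beta> continuous_map_snd continuous_map_fst])
  from continuous_map_compose[OF this quotient_imp_continuous_map[OF quotient_map_path_coset]]
  have "continuous_map (path_space X (\<beta> 1)) (free_paths (path_coset_space X x H)) (standard_lift \<beta>)"
    unfolding standard_lift_def by (intro continuous_map_into_free_paths) (simp add: o_def)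
  moreover have "standard_lift \<beta> \<alpha> 0 = path_coset X x H \<beta>" if "\<alpha> \<in> topspace (path_space X (\<beta> 1))" for \<alpha>
  proof -
    have "trunc_path 0 \<alpha> = restrict (\<lambda>_. \<beta> 1) {0..1}"
      using that by (simp add: trunc_path_def topspace_path_space)
    then show ?thesis
      using path_coset_homotopic[OF homotopic_right_unit[of \<beta> X x "\<beta> 1"]] \<beta>
      by (simp add: standard_lift_def path_space_paths_between)
  qed
  ultimately show ?thesis
    by (simp add: continuous_map_into_path_space)
qed

lemma compose_endpoint_standard_lift:
  assumes "\<beta> \<in> topspace (path_space X x)" and "\<alpha> \<in> topspace (path_space X (\<beta> 1))"
  shows "compose {0..1} endpoint (standard_lift \<beta> \<alpha>) = \<alpha>"
proof -
  have "endpoint (standard_lift \<beta> \<alpha> t) = \<alpha> t" if "t \<in> {0..1}" for t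
    using that endpoint_path_coset[OF concat_trunc_in_path_space[OF assms that]]
    by (simp add: standard_lift_def path_ends)
  then show ?thesis
    using assms(2) by (auto simp: compose_def topspace_path_space fun_eq_iff extensional_def)
qed

lemma standard_lift_1:
  assumes \<beta>: "\<beta> \<in> topspace (path_space X x)" and \<alpha>: "\<alpha> \<in> topspace (path_space X (\<beta> 1))"
  shows "standard_lift \<beta> \<alpha> 1 = path_coset X x H (concat_loops \<beta> \<alpha>)"
proof -
  have "trunc_path 1 \<alpha> = \<alpha>"
    using \<alpha> by (auto simp: trunc_path_def topspace_path_space extensional_def fun_eq_iff)
  then show ?thesis
    by (simp add: standard_lift_def)
qed

text \<open>Measured against the lift of its projection, a path in the path coset space traces out a path
  in the coset space of \<open>H\<close>. Its continuity is where the Hausdorff property enters: the pullback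
  \<open>Z\<close> is closed, so the quotient map restricts to a quotient map onto it.\<close>

lemma unique_standard_lift:
  assumes Haus: "Hausdorff_space X" and tpd: "totally_path_disconnected (coset_space X x H)"
    and \<beta>: "\<beta> \<in> topspace (path_space X x)"
    and \<gamma>: "\<gamma> \<in> topspace (path_space (path_coset_space X x H) (path_coset X x H \<beta>))"
  shows "standard_lift \<beta> (compose {0..1} endpoint \<gamma>) = \<gamma>"
proof -
  let ?E = "path_coset_space X x H" and ?q = "path_coset X x H"
  define c where "c = (\<lambda>\<alpha>. H #>\<^bsub>fundamental_group X x\<^esub> loop_class X x \<alpha>)"
  define \<alpha> where "\<alpha> = compose {0..1} endpoint \<gamma>"
  have \<gamma>_path: "pathin ?E \<gamma>" and \<gamma>0: "\<gamma> 0 = ?q \<beta>" and \<gamma>_ext: "\<gamma> \<in> extensional {0..1}"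
    using \<gamma> by (auto simp: topspace_path_space)
  have \<alpha>_t: "\<alpha> t = endpoint (\<gamma> t)" if "t \<in> {0..1}" for t
    using that by (simp add: \<alpha>_def compose_def)
  have \<alpha>: "\<alpha> \<in> topspace (path_space X (\<beta> 1))"
    using pathin_compose[OF \<gamma>_path continuous_map_endpoint] \<gamma>0 endpoint_path_coset[OF \<beta>]
    by (simp add: topspace_path_space \<alpha>_def compose_def pathin_restrict o_def)
  \<comment> \<open>A continuous choice of representatives along the standard lift, against which
    \<gamma> is measured.\<close>
  define \<epsilon> where "\<epsilon> = (\<lambda>t. concat_loops \<beta> (trunc_path t \<alpha>))"
  have \<epsilon>: "\<epsilon> t \<in> topspace (path_space X x)" and \<epsilon>1: "\<epsilon> t 1 = \<alpha> t" if "t \<in> {0..1}" for t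
    using concat_trunc_in_path_space[OF \<beta> \<alpha> that] by (simp_all add: \<epsilon>_def path_ends)
  have \<epsilon>_cont: "continuous_map unit_interval (path_space X x) \<epsilon>"
    unfolding \<epsilon>_def using \<alpha>
    by (intro continuous_map_concat_trunc[OF \<beta>]) (simp_all add: continuous_map_id[unfolded id_def])
  define P where "P = prod_topology unit_interval (path_space X x)"
  define W where "W = {w \<in> topspace P. snd w 1 = \<alpha> (fst w)}"
  define Z where "Z = {w \<in> topspace (prod_topology unit_interval ?E). endpoint (snd w) = \<alpha> (fst w)}"
  have "continuous_map unit_interval X \<alpha>"
    using \<alpha> by (simp add: topspace_path_space pathin_def)
  from continuous_map_compose[OF continuous_map_fst this]
  have "continuous_map (prod_topology unit_interval ?E) X (\<lambda>w. \<alpha> (fst w))"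
    by (simp add: o_def)
  moreover have "continuous_map (prod_topology unit_interval ?E) X (\<lambda>w. endpoint (snd w))"
    using continuous_map_compose[OF continuous_map_snd continuous_map_endpoint] by (simp add: o_def)
  ultimately have Z: "closedin (prod_topology unit_interval ?E) Z"
    unfolding Z_def by (intro closedin_continuous_maps_eq[OF Haus])
  have "locally_compact_space unit_interval"
    by (rule compact_imp_locally_compact_space) (simp add: compact_space_subtopology)
  moreover have "Hausdorff_space unit_interval"
    by (simp add: Hausdorff_space_subtopology)
  \<comment> \<open>The product of a quotient map with the identity of the interval is again a
    quotient map because the interval is locally compact Hausdorff. Functions of a time and a
    representative can thus descend to functions of a time and a class.\<close>
  ultimately have "quotient_map P (prod_topology unit_interval ?E) (\<lambda>(t, \<delta>). (t, ?q \<delta>))"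
    unfolding P_def by (intro quotient_map_prod_right disjI1 quotient_map_path_coset)
  \<comment> \<open>The restriction to a closed set \<open>Z\<close> is a quotient map when taken on
    the full preimage of \<open>Z\<close>, which is \<open>W\<close>.\<close>
  moreover have "{w \<in> topspace P. (\<lambda>(t, \<delta>). (t, ?q \<delta>)) w \<in> Z} = W"
    using endpoint_path_coset by (auto simp: W_def Z_def P_def topspace_path_coset_space)
  ultimately have q: "quotient_map (subtopology P W) (subtopology (prod_topology unit_interval ?E) Z) (\<lambda>(t, \<delta>). (t, ?q \<delta>))"
    using Z by (intro quotient_map_restriction) auto
  have W: "fst w \<in> {0..1}" "snd w \<in> topspace (path_space X x)" "snd w 1 = \<epsilon> (fst w) 1" if "w \<in> W" for w
    using that \<epsilon>1 by (auto simp: W_def P_def)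
  define \<Delta> where "\<Delta> = (\<lambda>w. concat_loops (snd w) (rev_path (\<epsilon> (fst w))))"
  have \<Delta>_loop: "\<Delta> w \<in> topspace (loop_space X x)" if "w \<in> W" for w
    unfolding \<Delta>_def using W[OF that] \<epsilon> by (intro difference_loop) auto
  have "continuous_map (subtopology P W) (loop_space X x) \<Delta>"
    unfolding continuous_map_into_loop_space
  proof (intro conjI ballI)
    have fst: "continuous_map (subtopology P W) unit_interval fst"
      and snd: "continuous_map (subtopology P W) (path_space X x) snd"
      unfolding P_def by (auto intro: continuous_map_from_subtopology continuous_map_fst continuous_map_snd)
    from continuous_map_compose[OF fst \<epsilon>_cont]
    have "continuous_map (subtopology P W) (free_paths X) (\<lambda>w. \<epsilon> (fst w))"
      by (simp add: o_def continuous_map_into_path_space)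
    then show "continuous_map (subtopology P W) (free_paths X) \<Delta>"
      unfolding \<Delta>_def using snd W
      by (intro continuous_map_concat_loops continuous_map_rev_path)
        (auto simp: continuous_map_into_path_space path_ends)
    fix w assume "w \<in> topspace (subtopology P W)"
    then show "\<Delta> w 0 = x" "\<Delta> w 1 = x"
      using \<Delta>_loop by (auto simp: topspace_loop_space)
  qed
  then have "continuous_map (subtopology P W) (coset_space X x H) (c \<circ> \<Delta>)"
    unfolding c_def by (rule continuous_map_compose[OF _ quotient_imp_continuous_map[OF quotient_map_coset_space]])
  \<comment> \<open>Both difference loops are taken against the same path
    \<open>\<epsilon> t\<close>, which cancels from their quotient; what remains is the class of
    \<delta> followed by \<delta>' reversed, and this lies in \<open>H\<close>.\<close>
  moreover have "(c \<circ> \<Delta>) v = (c \<circ> \<Delta>) w"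
    if "v \<in> W" "w \<in> W" and eq: "(\<lambda>(t, \<delta>). (t, ?q \<delta>)) v = (\<lambda>(t, \<delta>). (t, ?q \<delta>)) w" for v w
  proof -
    obtain t \<delta> \<delta>' where v: "v = (t, \<delta>)" and w: "w = (t, \<delta>')" and "?q \<delta> = ?q \<delta>'"
      using eq by (cases v; cases w) auto
    note Wv = W[OF that(1), unfolded v fst_conv snd_conv] and Ww = W[OF that(2), unfolded w fst_conv snd_conv]
    have "loop_class X x (concat_loops \<delta> (rev_path \<delta>')) \<in> H"
      using path_coset_eq_iff[OF Wv(2) Ww(2)] \<open>?q \<delta> = ?q \<delta>'\<close> by simp
    moreover have "loop_class X x (concat_loops (\<Delta> v) (rev_path (\<Delta> w))) = loop_class X x (concat_loops \<delta> (rev_path \<delta>'))"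
    proof -
      have "loop_class X x (concat_loops (\<Delta> v) (rev_path (\<Delta> w))) =
          loop_class X x (\<Delta> v) \<otimes>\<^bsub>fundamental_group X x\<^esub> inv\<^bsub>fundamental_group X x\<^esub> loop_class X x (\<Delta> w)"
        using \<Delta>_loop[OF that(1)] \<Delta>_loop[OF that(2)]
        by (simp add: inv_fundamental_group mult_fundamental_group rev_loop)
      also have "\<dots> = loop_class X x (concat_loops \<delta> (rev_path \<delta>'))"
        using difference_loop_inv[OF Ww(2) \<epsilon>[OF Ww(1)] Ww(3)]
          difference_loop_mult[OF Wv(2) \<epsilon>[OF Wv(1)] Ww(2) Wv(3) Ww(3)[symmetric]]
        by (simp add: \<Delta>_def v w)
      finally show ?thesis .
    qed
    ultimately show ?thesis
      using coset_eq_iff[OF H \<Delta>_loop[OF that(1)] \<Delta>_loop[OF that(2)]] by (simp add: c_def)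
  qed
  \<comment> \<open>The coset of the difference loop, now a continuous function of the time and the
    class alone.\<close>
  ultimately obtain k where k: "continuous_map (subtopology (prod_topology unit_interval ?E) Z) (coset_space X x H) k"
    and kW: "\<And>w. w \<in> W \<Longrightarrow> k ((\<lambda>(t, \<delta>). (t, ?q \<delta>)) w) = (c \<circ> \<Delta>) w"
    using quotient_map_lift_exists[OF q, of "coset_space X x H" "c \<circ> \<Delta>"]
    by (metis (no_types, lifting) IntD2 topspace_subtopology IntI W_def mem_Collect_eq)
  have \<gamma>_rep: "\<exists>\<delta>. (t, \<delta>) \<in> W \<and> \<gamma> t = ?q \<delta>" if t: "t \<in> {0..1}" for t
  proof -
    obtain \<delta> where \<delta>: "\<delta> \<in> topspace (path_space X x)" "\<gamma> t = ?q \<delta>"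
      using pathin_in_topspace[OF \<gamma>_path t] by (auto simp: topspace_path_coset_space)
    then show ?thesis
      using t by (auto simp: W_def P_def \<alpha>_t endpoint_path_coset)
  qed
  have "continuous_map unit_interval (prod_topology unit_interval ?E) (\<lambda>t. (t, \<gamma> t))"
    using \<gamma>_path by (intro continuous_map_pairedI) (simp_all add: pathin_def continuous_map_id[unfolded id_def])
  then have "continuous_map unit_interval (subtopology (prod_topology unit_interval ?E) Z) (\<lambda>t. (t, \<gamma> t))"
    using pathin_in_topspace[OF \<gamma>_path] by (intro continuous_map_into_subtopology) (auto simp: Z_def \<alpha>_t)
  then have "pathin (coset_space X x H) (\<lambda>t. k (t, \<gamma> t))"
    unfolding pathin_def using continuous_map_compose[OF _ k] by (fastforce simp: o_def)
  \<comment> \<open>Total path-disconnectedness enters here: the coset measured along \<gamma>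
    cannot move.\<close>
  then have const: "k (t, \<gamma> t) = k (0, \<gamma> 0)" if "t \<in> {0..1}" for t
    using tpd that unfolding totally_path_disconnected_def by (meson atLeastAtMost_iff order_refl zero_le_one)
  \<comment> \<open>The trivial coset detects agreement with the standard lift, since the difference
    loop has its class in \<open>H\<close> precisely if \<delta> and \<open>\<epsilon> t\<close>
    represent the same class.\<close>
  have k_one: "k (t, ?q \<delta>) = c (restrict (\<lambda>_. x) {0..1}) \<longleftrightarrow> ?q \<delta> = ?q (\<epsilon> t)" if "(t, \<delta>) \<in> W" for t \<delta>
  proof -
    note Wt = W[OF that, unfolded fst_conv snd_conv]
    have one: "restrict (\<lambda>_. x) {0..1} \<in> topspace (loop_space X x)"
      by (rule const_loop[OF base_in_topspace[OF \<beta>]])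
    have "rev_path (restrict (\<lambda>_. x) {0..1}) = restrict (\<lambda>_. x) {0..1}"
      by (auto simp: rev_path_def fun_eq_iff)
    then have "loop_class X x (concat_loops (\<Delta> (t, \<delta>)) (rev_path (restrict (\<lambda>_. x) {0..1}))) = loop_class X x (\<Delta> (t, \<delta>))"
      using homotopic_right_unit[of "\<Delta> (t, \<delta>)" X x x] \<Delta>_loop[OF that] one
      by (simp add: loop_class_eq_iff concat_loop flip: loop_space_eq)
    then have "c (\<Delta> (t, \<delta>)) = c (restrict (\<lambda>_. x) {0..1}) \<longleftrightarrow> loop_class X x (\<Delta> (t, \<delta>)) \<in> H"
      using coset_eq_iff[OF H \<Delta>_loop[OF that] one] by (simp add: c_def)
    also have "\<dots> \<longleftrightarrow> ?q \<delta> = ?q (\<epsilon> t)"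
      using path_coset_eq_iff[OF Wt(2) \<epsilon>[OF Wt(1)]] Wt(3) by (simp add: \<Delta>_def)
    finally show ?thesis
      using kW[OF that] by simp
  qed
  \<comment> \<open>The standard lift also starts at the class of \<beta>, so the constant coset is
    the trivial one.\<close>
  have "\<gamma> 0 = ?q (\<epsilon> 0)"
    using continuous_map_image_subset_topspace[OF continuous_map_standard_lift[OF \<beta>]] \<alpha> \<gamma>0
    by (force simp: topspace_path_space standard_lift_def \<epsilon>_def)
  moreover obtain \<delta>0 where "(0, \<delta>0) \<in> W" "\<gamma> 0 = ?q \<delta>0"
    using \<gamma>_rep[of 0] by auto
  ultimately have k0: "k (0, \<gamma> 0) = c (restrict (\<lambda>_. x) {0..1})"
    using k_one[of 0 \<delta>0] by simp
  have "\<gamma> t = ?q (\<epsilon> t)" if t: "t \<in> {0..1}" for t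
  proof -
    obtain \<delta> where "(t, \<delta>) \<in> W" "\<gamma> t = ?q \<delta>"
      using \<gamma>_rep[OF t] by blast
    then show ?thesis
      using k_one[of t \<delta>] const[OF t] k0 by simp
  qed
  then show ?thesis
    using \<gamma>_ext unfolding \<alpha>_def[symmetric] standard_lift_def \<epsilon>_def
    by (auto simp: fun_eq_iff extensional_def)
qed

section \<open>The space of classes as a path covering\<close>

context
  assumes Haus: "Hausdorff_space X" and tpd: "totally_path_disconnected (coset_space X x H)"
    and x: "x \<in> topspace X"
begin

lemma homeomorphic_maps_standard_lift:
  assumes "\<beta> \<in> topspace (path_space X x)"
  shows "homeomorphic_maps (path_space (path_coset_space X x H) (path_coset X x H \<beta>)) (path_space X (\<beta> 1))
    (compose {0..1} endpoint) (standard_lift \<beta>)"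
  unfolding homeomorphic_maps_def
proof (intro conjI ballI)
  have "continuous_map (path_space (path_coset_space X x H) (path_coset X x H \<beta>)) (free_paths X) (compose {0..1} endpoint)"
    using continuous_map_compose_path[OF continuous_map_path_space_free continuous_map_endpoint] .
  then show "continuous_map (path_space (path_coset_space X x H) (path_coset X x H \<beta>)) (path_space X (\<beta> 1))
     (compose {0..1} endpoint)"
    using endpoint_path_coset[OF assms]
    by (auto simp: continuous_map_into_path_space topspace_path_space compose_def)
qed (use assms continuous_map_standard_lift unique_standard_lift[OF Haus tpd] compose_endpoint_standard_lift in auto)

text \<open>Path connectedness comes from the standard lifts themselves: lifted from the class of
  the constant path, \<beta> ends at its own class.\<close>

lemma path_coset_space_path_covering: "path_covering_map (path_coset_space X x H) X endpoint"
  unfolding path_covering_map_def has_continuous_path_covering_def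
proof (intro conjI ballI)
  let ?c = "restrict (\<lambda>_::real. x) {0..1}" and ?E = "path_coset_space X x H" and ?q = "path_coset X x H"
  have c: "?c \<in> topspace (path_space X x)"
    using x by (rule const_in_path_space)
  then show "topspace ?E \<noteq> {}"
    by (auto simp: topspace_path_coset_space)
  show "continuous_map ?E X endpoint"
    by (rule continuous_map_endpoint)
  show "homeomorphic_map (path_space ?E C) (path_space X (endpoint C)) (compose {0..1} endpoint)"
    if C: "C \<in> topspace ?E" for C
  proof -
    obtain \<beta> where "\<beta> \<in> topspace (path_space X x)" "C = ?q \<beta>"
      using C by (auto simp: topspace_path_coset_space)
    then show ?thesis
      using homeomorphic_maps_standard_lift[of \<beta>] by (auto simp: homeomorphic_maps_map endpoint_path_coset)
  qed
  have "path_component_of ?E (?q ?c) (?q \<beta>)" if \<beta>: "\<beta> \<in> topspace (path_space X x)" for \<beta>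
  proof -
    have \<beta>': "\<beta> \<in> topspace (path_space X (?c 1))"
      using \<beta> by simp
    have "standard_lift ?c \<beta> \<in> topspace (path_space ?E (?q ?c))"
      using continuous_map_image_subset_topspace[OF continuous_map_standard_lift[OF c]] \<beta>' by blast
    moreover have "standard_lift ?c \<beta> 1 = ?q \<beta>"
      unfolding standard_lift_1[OF c \<beta>'] using \<beta>
      by (intro path_coset_homotopic[OF homotopic_left_unit[of \<beta> X x "\<beta> 1"]])
        (simp add: path_space_paths_between)
    ultimately show ?thesis
      unfolding path_component_of_def by (auto simp: topspace_path_space)
  qed
  then show "path_connected_space ?E"
    unfolding path_connected_space_iff_path_component topspace_path_coset_space
    by (blast intro: path_component_of_sym path_component_of_trans)
qed

text \<open>At the class of \<beta>, prefix a path \<delta> from \<open>x\<close> with \<beta>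
  reversed, take the standard lift and evaluate at 1: the result is the class of \<delta>, since
  \<beta> cancels. So evaluation is the last factor of a composite that is a quotient map, with
  continuous factors, and is a quotient map itself.\<close>

lemma path_coset_space_ev1_quotient: "ev1_quotient (path_coset_space X x H)"
  unfolding ev1_quotient_def
proof
  let ?E = "path_coset_space X x H" and ?q = "path_coset X x H"
  fix C assume "C \<in> topspace ?E"
  then obtain \<beta> where \<beta>: "\<beta> \<in> topspace (path_space X x)" and C: "C = ?q \<beta>"
    by (auto simp: topspace_path_coset_space)
  define s where "s = (\<lambda>\<delta>. concat_loops (rev_path \<beta>) \<delta>)"
  have s: "continuous_map (path_space X x) (path_space X (\<beta> 1)) s"
    unfolding s_def continuous_map_into_path_space using \<beta>
    by (auto intro!: continuous_map_concat_loops continuous_map_rev_path continuous_map_path_space_free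
      simp: path_ends topspace_path_space topspace_free_paths)
  have "(standard_lift \<beta> (s \<delta>)) 1 = ?q \<delta>" if \<delta>: "\<delta> \<in> topspace (path_space X x)" for \<delta>
  proof -
    have "s \<delta> \<in> topspace (path_space X (\<beta> 1))"
      using continuous_map_image_subset_topspace[OF s] \<delta> by blast
    then have "(standard_lift \<beta> (s \<delta>)) 1 = ?q (concat_loops \<beta> (s \<delta>))"
      by (rule standard_lift_1[OF \<beta>])
    also have "\<dots> = ?q \<delta>"
      unfolding s_def using \<beta> \<delta>
      by (intro path_coset_homotopic[OF homotopic_cancel_left[of \<beta> X x "\<beta> 1" \<delta> "\<delta> 1"]])
        (simp_all add: path_space_paths_between)
    finally show ?thesis .
  qed
  then have "quotient_map (path_space X x) ?E ((\<lambda>\<alpha>. \<alpha> 1) \<circ> (standard_lift \<beta> \<circ> s))"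
    by (intro quotient_map_eq[OF quotient_map_path_coset]) simp
  then show "quotient_map (path_space ?E C) ?E (\<lambda>\<alpha>. \<alpha> 1)"
    unfolding C
    by (rule quotient_map_from_composition[OF continuous_map_compose[OF s continuous_map_standard_lift[OF \<beta>]] continuous_map_ev1])
qed

text \<open>The lift of a loop from the base class ends at the class of the loop, so it closes up
  precisely if the loop has its homotopy class in \<open>H\<close>. By
  \<open>mem_subgroup_iff_lifts_meet\<close> it also closes up precisely if that homotopy class is
  in the image of the fundamental group.\<close>

lemma path_coset_space_realizes_subgroup:
  "realizes_subgroup X x H (path_coset_space X x H) endpoint (path_coset X x H (restrict (\<lambda>_. x) {0..1}))"
  unfolding realizes_subgroup_def
proof (intro conjI)
  let ?c = "restrict (\<lambda>_::real. x) {0..1}" and ?E = "path_coset_space X x H" and ?q = "path_coset X x H"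
  have c: "?c \<in> topspace (path_space X x)"
    using x by (rule const_in_path_space)
  show cov: "path_covering_map ?E X endpoint"
    by (rule path_coset_space_path_covering)
  then have cov: "has_continuous_path_covering ?E X endpoint"
    by (simp add: path_covering_map_def)
  show e: "?q ?c \<in> topspace ?E"
    using c by (auto simp: topspace_path_coset_space)
  show pe: "endpoint (?q ?c) = x"
    using endpoint_path_coset[OF c] by simp
  let ?H = "fundamental_group_map X x endpoint ` carrier (fundamental_group ?E (?q ?c))"
  have H': "subgroup ?H (fundamental_group X x)"
    using subgroup_image_fundamental_group_map[OF continuous_map_endpoint e] pe by simp
  have lift: "path_lift ?E endpoint (?q ?c) \<alpha> 1 = ?q \<alpha>" if \<alpha>: "\<alpha> \<in> topspace (path_space X x)" for \<alpha>
  proof -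
    have \<alpha>': "\<alpha> \<in> topspace (path_space X (?c 1))"
      using \<alpha> by simp
    have "standard_lift ?c \<alpha> \<in> topspace (path_space ?E (?q ?c))"
      using continuous_map_image_subset_topspace[OF continuous_map_standard_lift[OF c]] \<alpha>' by blast
    then have "path_lift ?E endpoint (?q ?c) \<alpha> = standard_lift ?c \<alpha>"
      using path_lift_compose[OF cov e] compose_endpoint_standard_lift[OF c \<alpha>'] by metis
    then have "path_lift ?E endpoint (?q ?c) \<alpha> 1 = ?q (concat_loops ?c \<alpha>)"
      using standard_lift_1[OF c \<alpha>'] by metis
    also have "\<dots> = ?q \<alpha>"
      using \<alpha> by (intro path_coset_homotopic[OF homotopic_left_unit[of \<alpha> X x "\<alpha> 1"]])
        (simp add: path_space_paths_between)
    finally show ?thesis .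
  qed
  have iff: "loop_class X x \<alpha> \<in> ?H \<longleftrightarrow> loop_class X x \<alpha> \<in> H" if \<alpha>: "\<alpha> \<in> topspace (loop_space X x)" for \<alpha>
  proof -
    have \<alpha>': "\<alpha> \<in> topspace (path_space X x)" and \<alpha>1: "\<alpha> 1 = x"
      using \<alpha> by (auto simp: topspace_loop_space topspace_path_space)
    have "rev_path ?c = ?c"
      by (auto simp: rev_path_def fun_eq_iff)
    then have "loop_class X x (concat_loops \<alpha> (rev_path ?c)) = loop_class X x \<alpha>"
      using homotopic_right_unit[of \<alpha> X x x] \<alpha> const_loop[OF x]
      by (simp add: loop_class_eq_iff concat_loop flip: loop_space_eq)
    moreover have "loop_class X x (concat_loops \<alpha> (rev_path ?c)) \<in> ?H \<longleftrightarrow> ?q \<alpha> = ?q ?c"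
      using mem_subgroup_iff_lifts_meet[OF cov e, of \<alpha> x ?c] \<alpha> const_loop[OF x] lift[OF \<alpha>'] lift[OF c]
      by (simp add: pe loop_space_eq)
    moreover have "?q \<alpha> = ?q ?c \<longleftrightarrow> loop_class X x (concat_loops \<alpha> (rev_path ?c)) \<in> H"
      using path_coset_eq_iff[OF \<alpha>' c] \<alpha>1 by simp
    ultimately show ?thesis by simp
  qed
  \<comment> \<open>Both sides consist of loop classes, so membership can be tested on
    representatives.\<close>
  show "?H = H"
  proof (intro Set.set_eqI iffI)
    fix A
    show "A \<in> H" if A: "A \<in> ?H"
    proof -
      have "A \<in> carrier (fundamental_group X x)"
        by (rule subgroup.mem_carrier[OF H' A])
      then obtain \<alpha> where "\<alpha> \<in> topspace (loop_space X x)" "A = loop_class X x \<alpha>"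
        unfolding carrier_fundamental_group by (rule imageE)
      then show ?thesis using iff A by metis
    qed
    show "A \<in> ?H" if A: "A \<in> H"
    proof -
      have "A \<in> carrier (fundamental_group X x)"
        by (rule subgroup.mem_carrier[OF H A])
      then obtain \<alpha> where "\<alpha> \<in> topspace (loop_space X x)" "A = loop_class X x \<alpha>"
        unfolding carrier_fundamental_group by (rule imageE)
      then show ?thesis using iff A by metis
    qed
  qed
qed

end

end

section \<open>Classification\<close>

text \<open>The class of a path and the end point of its lift determine each other: by the lifting
  criterion for paths with a common end in \<open>X\<close>, by projection otherwise. If evaluation
  is a quotient map, so is its composite with the lifting homeomorphism; this composite factors
  through \<open>f\<close>, which is then an injective quotient map.\<close>

lemma path_coset_space_bijection:
  fixes E :: "'e topology" and X :: "'a topology"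
  assumes R: "realizes_subgroup X x H E p e"
  obtains f where "continuous_map (path_coset_space X x H) E f"
    and "bij_betw f (topspace (path_coset_space X x H)) (topspace E)"
    and "\<And>C. C \<in> topspace (path_coset_space X x H) \<Longrightarrow> p (f C) = endpoint C"
    and "ev1_quotient E \<Longrightarrow> homeomorphic_map (path_coset_space X x H) E f"
proof -
  have cov: "has_continuous_path_covering E X p" and pc: "path_connected_space E"
    and e: "e \<in> topspace E" and x: "p e = x"
    and H_eq: "H = fundamental_group_map X x p ` carrier (fundamental_group E e)"
    using R by (auto simp: realizes_subgroup_def path_covering_map_def)
  have H: "subgroup H (fundamental_group X x)"
    using subgroup_image_fundamental_group_map[OF covering_continuous[OF cov e] e] by (simp add: x H_eq)
  let ?E = "path_coset_space X x H" and ?q = "path_coset X x H" and ?L = "path_lift E p e"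
  note q = quotient_map_path_coset[where X = X and x = x and H = H]
  have q_eq: "?q \<alpha> = ?q \<beta> \<longleftrightarrow> ?L \<alpha> 1 = ?L \<beta> 1"
    if \<alpha>: "\<alpha> \<in> topspace (path_space X x)" and \<beta>: "\<beta> \<in> topspace (path_space X x)" for \<alpha> \<beta>
  proof (cases "\<alpha> 1 = \<beta> 1")
    case True
    then show ?thesis
      using mem_subgroup_iff_lifts_meet[OF cov e, of \<alpha> "\<alpha> 1" \<beta>] path_coset_eq_iff[OF H \<alpha> \<beta>] \<alpha> \<beta>
      by (simp add: x H_eq path_space_paths_between)
  next
    case False
    then show ?thesis
      using path_coset_eq_iff[OF H \<alpha> \<beta>] path_lift_ends(2)[OF cov e, unfolded x] \<alpha> \<beta> by metis
  qed
  have lift: "continuous_map (path_space X x) (path_space E e) ?L"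
    using continuous_map_path_lift[OF cov e] by (simp add: x)
  then have "continuous_map (path_space X x) E (\<lambda>\<alpha>. ?L \<alpha> 1)"
    using continuous_map_compose[OF lift continuous_map_ev1] by (simp add: o_def)
  then obtain f where f: "continuous_map ?E E f"
    and fq: "\<And>\<alpha>. \<alpha> \<in> topspace (path_space X x) \<Longrightarrow> f (?q \<alpha>) = ?L \<alpha> 1"
    using quotient_map_lift_exists[OF q, of E "\<lambda>\<alpha>. ?L \<alpha> 1"] q_eq by metis
  have inj: "inj_on f (topspace ?E)"
  proof (rule inj_onI)
    fix C D assume "C \<in> topspace ?E" "D \<in> topspace ?E" and "f C = f D"
    then obtain \<alpha> \<beta> where "\<alpha> \<in> topspace (path_space X x)" "C = ?q \<alpha>"
      "\<beta> \<in> topspace (path_space X x)" "D = ?q \<beta>"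
      by (auto simp: topspace_path_coset_space)
    then show "C = D"
      using \<open>f C = f D\<close> fq q_eq by metis
  qed
  have "y \<in> f ` topspace ?E" if y: "y \<in> topspace E" for y
  proof -
    obtain g where g: "pathin E g" "g 0 = e" "g 1 = y"
      using pc e y unfolding path_connected_space_def by blast
    then have \<gamma>: "restrict g {0..1} \<in> topspace (path_space E e)"
      by (simp add: topspace_path_space pathin_restrict)
    have \<alpha>: "compose {0..1} p (restrict g {0..1}) \<in> topspace (path_space X x)"
      using compose_in_path_space[OF cov e \<gamma>] by (simp add: x)
    have "f (?q (compose {0..1} p (restrict g {0..1}))) = y"
      using fq[OF \<alpha>] path_lift_compose[OF cov e \<gamma>] g by simp
    then show ?thesis
      using \<alpha> by (auto simp: topspace_path_coset_space)
  qed
  then have surj: "f ` topspace ?E = topspace E"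
    using continuous_map_image_subset_topspace[OF f] by blast
  have proj: "p (f C) = endpoint C" if "C \<in> topspace ?E" for C
    using that path_lift_ends(2)[OF cov e] by (auto simp: topspace_path_coset_space fq endpoint_path_coset[OF H] x)
  have "homeomorphic_map ?E E f" if "ev1_quotient E"
  proof -
    have "homeomorphic_map (path_space X x) (path_space E e) ?L"
      using homeomorphic_map_path_lift[OF cov e] by (simp add: homeomorphic_maps_map x)
    moreover have "quotient_map (path_space E e) E (\<lambda>\<alpha>. \<alpha> 1)"
      using that e by (simp add: ev1_quotient_def)
    ultimately have "quotient_map (path_space X x) E ((\<lambda>\<alpha>. \<alpha> 1) \<circ> ?L)"
      by (intro quotient_map_compose) (simp_all add: homeomorphic_map_def)
    then have "quotient_map (path_space X x) E (f \<circ> ?q)"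
      by (rule quotient_map_eq) (simp add: fq)
    then have "quotient_map ?E E f"
      by (rule quotient_map_from_composition[OF quotient_imp_continuous_map[OF q] f])
    then show ?thesis
      using inj by (simp add: homeomorphic_map_def)
  qed
  then show thesis
    using that f inj surj proj by (simp add: bij_betw_def)
qed

lemma realizes_subgroup_totally_path_disconnected:
  assumes "realizes_subgroup X x H E p e"
  shows "totally_path_disconnected (coset_space X x H)"
  using assms coset_space_totally_path_disconnected[of E X p e]
  by (auto simp: realizes_subgroup_def path_covering_map_def)

text \<open>A realization of \<open>H\<close> forces its coset space to be totally
  path-disconnected, which is what the construction of the space of classes requires.\<close>

lemma realizes_subgroup_path_coset_space:
  assumes Haus: "Hausdorff_space X" and R: "realizes_subgroup X x H E p e"
  shows "path_covering_map (path_coset_space X x H) X endpoint" and "ev1_quotient (path_coset_space X x H)"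
proof -
  have e: "e \<in> topspace E" and x: "p e = x" and p: "continuous_map E X p"
    and H: "H = fundamental_group_map X x p ` carrier (fundamental_group E e)"
    using R by (auto simp: realizes_subgroup_def path_covering_map_def has_continuous_path_covering_def)
  have "subgroup H (fundamental_group X x)"
    using subgroup_image_fundamental_group_map[OF p e] by (simp add: x H)
  moreover have "x \<in> topspace X"
    using continuous_map_image_subset_topspace[OF p] e x by blast
  ultimately show "path_covering_map (path_coset_space X x H) X endpoint" "ev1_quotient (path_coset_space X x H)"
    using Haus realizes_subgroup_totally_path_disconnected[OF R]
    by (simp_all add: path_coset_space_path_covering path_coset_space_ev1_quotient)
qed

text \<open>The space of classes for \<open>H\<close> maps to both total spaces by continuous
  bijections over \<open>X\<close>, so a single simple step connects them.\<close>

lemma realizes_subgroup_weakly_equivalent: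
  assumes Haus: "Hausdorff_space X"
    and R1: "realizes_subgroup X x H E1 p1 e1" and R2: "realizes_subgroup X x H E2 p2 e2"
  shows "weakly_equivalent X E1 p1 E2 p2"
proof -
  let ?E = "path_coset_space X x H"
  note cov = realizes_subgroup_path_coset_space(1)[OF Haus R1]
  have cov1: "path_covering_map E1 X p1" and cov2: "path_covering_map E2 X p2"
    using R1 R2 by (simp_all add: realizes_subgroup_def)
  obtain f1 where f1: "continuous_map ?E E1 f1" "bij_betw f1 (topspace ?E) (topspace E1)"
    "\<And>C. C \<in> topspace ?E \<Longrightarrow> p1 (f1 C) = endpoint C"
    using path_coset_space_bijection[OF R1] by blast
  obtain f2 where f2: "continuous_map ?E E2 f2" "bij_betw f2 (topspace ?E) (topspace E2)"
    "\<And>C. C \<in> topspace ?E \<Longrightarrow> p2 (f2 C) = endpoint C"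
    using path_coset_space_bijection[OF R2] by blast
  have "simple_weak_equivalence X E1 p1 E2 p2 ?E endpoint f1 f2"
    unfolding simple_weak_equivalence_def
    using cov cov1 cov2 f1(3) f2(3) bijection_weak_homotopy_equivalence[OF cov1 cov f1]
      bijection_weak_homotopy_equivalence[OF cov2 cov f2] by blast
  then show ?thesis
    unfolding weakly_equivalent_def simply_weakly_equivalent_def by blast
qed

text \<open>Both total spaces are homeomorphic over \<open>X\<close> to the space of classes, hence
  to each other.\<close>

lemma realizes_subgroup_equivalent:
  assumes R1: "realizes_subgroup X x H E1 p1 e1" "ev1_quotient E1"
    and R2: "realizes_subgroup X x H E2 p2 e2" "ev1_quotient E2"
  shows "equivalent_maps E1 p1 E2 p2"
proof -
  let ?E = "path_coset_space X x H"
  obtain f1 where f1: "homeomorphic_map ?E E1 f1" "\<And>C. C \<in> topspace ?E \<Longrightarrow> p1 (f1 C) = endpoint C"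
    using path_coset_space_bijection[OF R1(1)] R1(2) by blast
  obtain f2 where f2: "homeomorphic_map ?E E2 f2" "\<And>C. C \<in> topspace ?E \<Longrightarrow> p2 (f2 C) = endpoint C"
    using path_coset_space_bijection[OF R2(1)] R2(2) by blast
  obtain g where g: "homeomorphic_maps ?E E1 f1 g"
    using f1(1) homeomorphic_map_maps by blast
  have "homeomorphic_map E1 E2 (f2 \<circ> g)"
    using g f2(1) by (auto simp: homeomorphic_maps_map intro: homeomorphic_map_compose)
  moreover have "p2 ((f2 \<circ> g) y) = p1 y" if y: "y \<in> topspace E1" for y
  proof -
    have "continuous_map E1 ?E g" "f1 (g y) = y"
      using g y by (simp_all add: homeomorphic_maps_def)
    moreover from this(1) have "g y \<in> topspace ?E"
      using y continuous_map_image_subset_topspace by blast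
    ultimately show ?thesis
      using f1(2)[of "g y"] f2(2)[of "g y"] by simp
  qed
  ultimately show ?thesis
    unfolding equivalent_maps_def by blast
qed

text \<open>Every total space realizes the image of its own fundamental group, so it can be compared
  with the space of classes for that subgroup.\<close>

lemma weakly_equivalent_ev1_quotient:
  fixes E :: "'e topology" and X :: "'a topology"
  assumes Haus: "Hausdorff_space X" and cov: "path_covering_map E X p"
  shows "\<exists>(E' :: (real \<Rightarrow> 'a) set topology) p'.
    path_covering_map E' X p' \<and> ev1_quotient E' \<and> weakly_equivalent X E p E' p'"
proof -
  obtain e where e: "e \<in> topspace E"
    using cov unfolding path_covering_map_def by blast
  define H where "H = fundamental_group_map X (p e) p ` carrier (fundamental_group E e)"
  have R: "realizes_subgroup X (p e) H E p e"
    using cov e by (simp add: realizes_subgroup_def H_def)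
  have p: "continuous_map E X p"
    using cov by (simp add: path_covering_map_def has_continuous_path_covering_def)
  have H: "subgroup H (fundamental_group X (p e))"
    unfolding H_def by (rule subgroup_image_fundamental_group_map[OF p e])
  have "p e \<in> topspace X"
    using continuous_map_image_subset_topspace[OF p] e by blast
  note R' = path_coset_space_realizes_subgroup[OF H Haus realizes_subgroup_totally_path_disconnected[OF R] this]
  show ?thesis
    using realizes_subgroup_path_coset_space[OF Haus R] realizes_subgroup_weakly_equivalent[OF Haus R R']
    by (intro exI conjI)
qed

text \<open>Existence refers to total spaces over the type
  \<open>(real \<Rightarrow> 'a) set\<close>, into which every total space injects; necessity and
  uniqueness are also asserted for total spaces of arbitrary point types.\<close>

theorem theorem1p2:
  fixes X :: "'a topology" and x0 :: 'a and H :: "(real \<Rightarrow> 'a) set set"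
  assumes "Hausdorff_space X" and "path_connected_space X" and "x0 \<in> topspace X"
    and "subgroup H (fundamental_group X x0)"
  shows
    "((\<exists>(E :: (real \<Rightarrow> 'a) set topology) p e0. realizes_subgroup X x0 H E p e0)
        \<longleftrightarrow> totally_path_disconnected (coset_space X x0 H)) \<and>
     (\<forall>(E :: 'b topology) p e0. realizes_subgroup X x0 H E p e0
        \<longrightarrow> totally_path_disconnected (coset_space X x0 H)) \<and>
     (\<forall>(E1 :: 'b topology) p1 e1 (E2 :: 'c topology) p2 e2.
        realizes_subgroup X x0 H E1 p1 e1 \<and> realizes_subgroup X x0 H E2 p2 e2
        \<longrightarrow> weakly_equivalent X E1 p1 E2 p2) \<and>
     ((\<exists>(E :: (real \<Rightarrow> 'a) set topology) p e0. realizes_subgroup X x0 H E p e0 \<and> ev1_quotient E)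
        \<longleftrightarrow> totally_path_disconnected (coset_space X x0 H)) \<and>
     (\<forall>(E1 :: 'b topology) p1 e1 (E2 :: 'c topology) p2 e2.
        realizes_subgroup X x0 H E1 p1 e1 \<and> ev1_quotient E1 \<and>
        realizes_subgroup X x0 H E2 p2 e2 \<and> ev1_quotient E2
        \<longrightarrow> equivalent_maps E1 p1 E2 p2) \<and>
     (\<forall>(E :: 'b topology) p. path_covering_map E X p
        \<longrightarrow> (\<exists>(E' :: (real \<Rightarrow> 'a) set topology) p'.
              path_covering_map E' X p' \<and> ev1_quotient E' \<and> weakly_equivalent X E p E' p'))"
proof -
  \<comment> \<open>One space serves both existence claims.\<close>
  have exists: "\<exists>(E :: (real \<Rightarrow> 'a) set topology) p e0. realizes_subgroup X x0 H E p e0 \<and> ev1_quotient E"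
    if "totally_path_disconnected (coset_space X x0 H)"
    using path_coset_space_realizes_subgroup[OF assms(4,1) that assms(3)]
      path_coset_space_ev1_quotient[OF assms(4,1) that assms(3)] by (intro exI conjI)
  show ?thesis
  proof (intro conjI allI impI)
    show "totally_path_disconnected (coset_space X x0 H)" if "realizes_subgroup X x0 H E p e0"
      for E :: "'b topology" and p e0
      using that by (rule realizes_subgroup_totally_path_disconnected)
    show "weakly_equivalent X E1 p1 E2 p2"
      if "realizes_subgroup X x0 H E1 p1 e1 \<and> realizes_subgroup X x0 H E2 p2 e2"
      for E1 :: "'b topology" and p1 e1 and E2 :: "'c topology" and p2 e2
      using that realizes_subgroup_weakly_equivalent[OF assms(1)] by metis
    show "equivalent_maps E1 p1 E2 p2"
      if "realizes_subgroup X x0 H E1 p1 e1 \<and> ev1_quotient E1 \<and> realizes_subgroup X x0 H E2 p2 e2 \<and> ev1_quotient E2"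
      for E1 :: "'b topology" and p1 e1 and E2 :: "'c topology" and p2 e2
      using that realizes_subgroup_equivalent by metis
    show "\<exists>(E' :: (real \<Rightarrow> 'a) set topology) p'.
        path_covering_map E' X p' \<and> ev1_quotient E' \<and> weakly_equivalent X E p E' p'"
      if "path_covering_map E X p" for E :: "'b topology" and p
      using that by (rule weakly_equivalent_ev1_quotient[OF assms(1)])
    show "(\<exists>(E :: (real \<Rightarrow> 'a) set topology) p e0. realizes_subgroup X x0 H E p e0)
        \<longleftrightarrow> totally_path_disconnected (coset_space X x0 H)"
      and "(\<exists>(E :: (real \<Rightarrow> 'a) set topology) p e0. realizes_subgroup X x0 H E p e0 \<and> ev1_quotient E)
        \<longleftrightarrow> totally_path_disconnected (coset_space X x0 H)"
      using exists by (auto dest: realizes_subgroup_totally_path_disconnected)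
  qed
qed

end
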